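(* Let $n\ge 4$. For every $\mu=(\mu_1,\ldots,\mu_n)\in\mathbb{Z}_{\ge 0}^n$, the polynomial $x^{\mu}\mathfrak{S}_{1432}(x^{-1})=x_1^{\mu_1}\cdots x_n^{\mu_n}\,\mathfrak{S}_{1432}(x_1^{-1},\ldots,x_n^{-1})$ is not a Schubert polynomial, i.e. it is not equal to $\mathfrak{S}_u(x)$ for any permutation $u$.
   Context: Schubert polynomials: with $\partial_i f=(f-s_if)/(x_i-x_{i+1})$ ($s_i f$ swaps $x_i,x_{i+1}$), for $w_0=m\cdots 21\in S_m$ set $\mathfrak{S}_{w_0}=x_1^{m-1}x_2^{m-2}\cdots x_{m-1}$, and $\mathfrak{S}_w=\partial_i\mathfrak{S}_{ws_i}$ whenever $w_i<w_{i+1}$ ($ws_i$ swaps the entries in positions $i,i+1$); appending fixed points does not change $\mathfrak{S}_w$. In particular $\mathfrak{S}_{1432}(x)=x_1^2x_2+x_1^2x_3+x_1x_2^2+x_1x_2x_3+x_2^2x_3$. *)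

theory Defs
  imports "HOL-Library.Poly_Mapping" "HOL-Combinatorics.Permutations"
begin

(* Polynomials and Laurent polynomials over the integers in variables indexed by nat, as finitely
   supported maps from exponent vectors to coefficients.  The variable with index 0 is not used:
   x_1, x_2, ... are the variables with index 1, 2, ... *)

type_synonym zpoly = "(nat \<Rightarrow>\<^sub>0 nat) \<Rightarrow>\<^sub>0 int"
type_synonym zlaurent = "(nat \<Rightarrow>\<^sub>0 int) \<Rightarrow>\<^sub>0 int"

definition X :: "nat \<Rightarrow> zpoly" where
  "X i = Poly_Mapping.single (Poly_Mapping.single i 1) 1"

definition LX :: "nat \<Rightarrow> zlaurent" where
  "LX i = Poly_Mapping.single (Poly_Mapping.single i 1) 1"

definition LX_inv :: "nat \<Rightarrow> zlaurent" where
  "LX_inv i = Poly_Mapping.single (Poly_Mapping.single i (-1)) 1"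

definition poly_subst :: "(nat \<Rightarrow> 'a::comm_ring_1) \<Rightarrow> zpoly \<Rightarrow> 'a" where
  "poly_subst \<sigma> f =
     (\<Sum>a\<in>Poly_Mapping.keys f. of_int (Poly_Mapping.lookup f a) *
        (\<Prod>i\<in>Poly_Mapping.keys a. \<sigma> i ^ Poly_Mapping.lookup a i))"

definition swap_vars :: "nat \<Rightarrow> zpoly \<Rightarrow> zpoly" where
  "swap_vars i = poly_subst (\<lambda>j. X (transpose i (Suc i) j))"

(* The exact quotient (f - s_i f) / (x_i - x_(i+1)); it is unique (divdiff_eqI), since the
   polynomial ring is an integral domain, and f - s_i f is always divisible. *)
definition divdiff :: "nat \<Rightarrow> zpoly \<Rightarrow> zpoly" where
  "divdiff i f = (THE g. (X i - X (Suc i)) * g = f - swap_vars i f)"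

(* Permutations of {1..m} are functions on nat fixing everything outside {1..m}. *)
definition one_line :: "nat list \<Rightarrow> nat \<Rightarrow> nat" where
  "one_line ws i = (if i \<in> {1..length ws} then ws ! (i - 1) else i)"

definition longest_perm :: "nat \<Rightarrow> nat \<Rightarrow> nat" where
  "longest_perm m i = (if i \<in> {1..m} then m + 1 - i else i)"

(* "schubert_poly m w f": w is in S_m and f is its Schubert polynomial, i.e. f is obtained from the
   polynomial of the longest element by the recursion, along some choice of ascents.  (That f does
   not depend on the choice, nor on m, is the classical well-definedness of Schubert polynomials;
   existence is schubert_poly_exists.)
   Right multiplication by s_i, which swaps the entries in positions i and i+1, is composition
   with the transposition on the right. *)
inductive schubert_poly :: "nat \<Rightarrow> (nat \<Rightarrow> nat) \<Rightarrow> zpoly \<Rightarrow> bool" for m :: nat where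
  longest: "schubert_poly m (longest_perm m) (\<Prod>i\<in>{1..m}. X i ^ (m - i))"
| ascent: "\<lbrakk>w permutes {1..m}; 1 \<le> i; i < m; w i < w (Suc i);
            schubert_poly m (w \<circ> transpose i (Suc i)) f\<rbrakk>
           \<Longrightarrow> schubert_poly m w (divdiff i f)"

lemma LX_mult_LX_inv: "LX i * LX_inv i = 1"
  by (simp add: LX_def LX_inv_def mult_single flip: single_add)

definition monom_subst :: "(nat \<Rightarrow> 'a::comm_ring_1) \<Rightarrow> (nat \<Rightarrow>\<^sub>0 nat) \<Rightarrow> 'a" where
  "monom_subst \<sigma> a = (\<Prod>i\<in>Poly_Mapping.keys a. \<sigma> i ^ Poly_Mapping.lookup a i)"

lemma monom_subst_superset:
  assumes "finite A" "Poly_Mapping.keys a \<subseteq> A"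
  shows "monom_subst \<sigma> a = (\<Prod>i\<in>A. \<sigma> i ^ Poly_Mapping.lookup a i)"
  unfolding monom_subst_def
  by (rule prod.mono_neutral_left) (use assms in \<open>auto simp: in_keys_iff\<close>)

lemma monom_subst_add: "monom_subst \<sigma> (a + b) = monom_subst \<sigma> a * monom_subst \<sigma> b"
proof -
  let ?A = "Poly_Mapping.keys a \<union> Poly_Mapping.keys b"
  have "Poly_Mapping.keys (a + b) \<subseteq> ?A"
    by (rule keys_add)
  then show ?thesis
    by (simp add: monom_subst_superset[of ?A] lookup_add power_add prod.distrib)
qed

lemma poly_subst_altdef:
  "poly_subst \<sigma> f = (\<Sum>a\<in>Poly_Mapping.keys f. of_int (Poly_Mapping.lookup f a) * monom_subst \<sigma> a)"
  by (simp add: poly_subst_def monom_subst_def)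

lemma poly_subst_0 [simp]: "poly_subst \<sigma> 0 = 0"
  by (simp add: poly_subst_def)

lemma poly_subst_single: "poly_subst \<sigma> (Poly_Mapping.single a c) = of_int c * monom_subst \<sigma> a"
  by (simp add: poly_subst_altdef)

lemma poly_subst_1 [simp]: "poly_subst \<sigma> 1 = 1"
  by (simp add: poly_subst_def)

lemma poly_subst_X [simp]: "poly_subst \<sigma> (X i) = \<sigma> i"
  by (simp add: X_def poly_subst_single monom_subst_def)

lemma poly_subst_add: "poly_subst \<sigma> (f + g) = poly_subst \<sigma> f + poly_subst \<sigma> g"
  unfolding poly_subst_altdef
  by (rule setsum_keys_plus_distrib) (auto simp: distrib_right)

lemma poly_subst_sum: "poly_subst \<sigma> (\<Sum>i\<in>A. f i) = (\<Sum>i\<in>A. poly_subst \<sigma> (f i))"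
  by (induction A rule: infinite_finite_induct) (auto simp: poly_subst_add)

lemma sum_singles:
  "(f :: 'a \<Rightarrow>\<^sub>0 'b::comm_monoid_add) =
     (\<Sum>a\<in>Poly_Mapping.keys f. Poly_Mapping.single a (Poly_Mapping.lookup f a))"
  by (rule poly_mapping_eqI)
     (auto simp: lookup_sum lookup_single when_def sum.delta' in_keys_iff)

lemma poly_subst_mult: "poly_subst \<sigma> (f * g) = poly_subst \<sigma> f * poly_subst \<sigma> g"
proof -
  have "f * g = (\<Sum>a\<in>Poly_Mapping.keys f. \<Sum>b\<in>Poly_Mapping.keys g.
      Poly_Mapping.single (a + b) (Poly_Mapping.lookup f a * Poly_Mapping.lookup g b))"
    by (subst (1) sum_singles[of f], subst (1) sum_singles[of g])
       (simp add: sum_product mult_single)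
  then show ?thesis
    by (simp add: poly_subst_sum poly_subst_single monom_subst_add)
       (simp add: poly_subst_altdef sum_product mult_ac)
qed

lemma poly_subst_power: "poly_subst \<sigma> (f ^ k) = poly_subst \<sigma> f ^ k"
  by (induction k) (simp_all add: poly_subst_mult)

lemma X_neq: "i \<noteq> j \<Longrightarrow> X i \<noteq> X j"
proof
  assume "i \<noteq> j" "X i = X j"
  then have "Poly_Mapping.lookup (X i) (Poly_Mapping.single i 1) =
             Poly_Mapping.lookup (X j) (Poly_Mapping.single i 1)"
    by simp
  then have "Poly_Mapping.single i (1::nat) = Poly_Mapping.single j 1"
    by (auto simp: X_def lookup_single when_def split: if_splits)
  then have "Poly_Mapping.lookup (Poly_Mapping.single i (1::nat)) i =
             Poly_Mapping.lookup (Poly_Mapping.single j 1) i"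
    by simp
  with \<open>i \<noteq> j\<close> show False
    by (simp add: lookup_single)
qed

lemma divdiff_eqI:
  assumes "(X i - X (Suc i)) * g = f - swap_vars i f"
  shows "divdiff i f = g"
proof -
  have "X i - X (Suc i) \<noteq> 0"
    using X_neq[of i "Suc i"] by simp
  then show ?thesis
    unfolding divdiff_def using assms mult_left_cancel[of "X i - X (Suc i)" _ g]
    by (intro the_equality) simp_all
qed

lemma no_ascent_imp_longest:
  assumes w: "w permutes {1..m}" and *: "\<And>i. 1 \<le> i \<Longrightarrow> i < m \<Longrightarrow> w (Suc i) < w i"
  shows "w = longest_perm m"
proof
  fix i
  show "w i = longest_perm m i"
  proof (cases "i \<in> {1..m}")
    case False
    then show ?thesis
      using w by (auto simp: longest_perm_def permutes_def)
  next
    case True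
    have wm: "w j \<in> {1..m}" if "j \<in> {1..m}" for j
      using that permutes_in_image[OF w] by blast
    have up: "1 \<le> j \<longrightarrow> j \<le> m \<longrightarrow> w j + j \<le> m + 1" for j
    proof (induction j)
      case (Suc j)
      show ?case
      proof (cases "j = 0")
        case True
        then show ?thesis using wm[of 1] by auto
      next
        case False
        then show ?thesis using Suc *[of j] by auto
      qed
    qed simp
    have dn: "k < m \<longrightarrow> k + 1 \<le> w (m - k)" for k
    proof (induction k)
      case 0
      then show ?case using wm[of m] by auto
    next
      case (Suc k)
      show ?case
      proof
        assume "Suc k < m"
        then have "Suc (m - Suc k) = m - k" by simp
        then show "Suc k + 1 \<le> w (m - Suc k)"
          using Suc.IH *[of "m - Suc k"] \<open>Suc k < m\<close> by (cases "1 \<le> m - Suc k") auto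
      qed
    qed
    show ?thesis
      using True up[of i] dn[of "m - i"] by (auto simp: longest_perm_def)
  qed
qed

lemma schubert_poly_exists:
  assumes "w permutes {1..m}"
  shows "\<exists>f. schubert_poly m w f"
  using assms
proof (induction "\<Sum>i\<in>{1..m}. i * w i" arbitrary: w rule: less_induct)
  case less
  show ?case
  proof (cases "\<exists>i. 1 \<le> i \<and> i < m \<and> w i < w (Suc i)")
    case False
    have "w (Suc i) < w i" if "1 \<le> i" "i < m" for i
      using False that permutes_inj[OF less.prems]
      by (metis injD linorder_neqE_nat n_not_Suc_n)
    with less.prems have "w = longest_perm m"
      by (rule no_ascent_imp_longest)
    then show ?thesis
      using schubert_poly.longest by blast
  next
    case True
    then obtain i where i: "1 \<le> i" "i < m" "w i < w (Suc i)" by blast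
    let ?v = "w \<circ> transpose i (Suc i)"
    let ?R = "{1..m} - {i, Suc i}"
    have R: "{1..m} = insert i (insert (Suc i) ?R)"
      using i by auto
    have split: "(\<Sum>j\<in>{1..m}. j * h j) = i * h i + Suc i * h (Suc i) + (\<Sum>j\<in>?R. j * h j)"
      for h :: "nat \<Rightarrow> nat"
      by (subst R) simp
    have "(\<Sum>j\<in>?R. j * ?v j) = (\<Sum>j\<in>?R. j * w j)"
      by (rule sum.cong) (auto simp: transpose_def)
    moreover have "i * w (Suc i) + Suc i * w i < i * w i + Suc i * w (Suc i)"
      using i by simp
    ultimately have "(\<Sum>j\<in>{1..m}. j * ?v j) < (\<Sum>j\<in>{1..m}. j * w j)"
      unfolding split by simp
    moreover have "?v permutes {1..m}"
      using i by (intro permutes_compose[OF permutes_swap_id less.prems]) auto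
    ultimately obtain f where "schubert_poly m ?v f"
      using less.hyps by blast
    with i less.prems show ?thesis
      using schubert_poly.ascent by blast
  qed
qed

lemma schubert_poly_longest_iff:
  "schubert_poly m (longest_perm m) f \<longleftrightarrow> f = (\<Prod>i\<in>{1..m}. X i ^ (m - i))"
proof
  assume "schubert_poly m (longest_perm m) f"
  then show "f = (\<Prod>i\<in>{1..m}. X i ^ (m - i))"
    by cases (auto simp: longest_perm_def)
qed (simp only: schubert_poly.longest)

lemma schubert_poly_unique_ascent_iff:
  assumes w: "w permutes {1..m}" and i: "1 \<le> i" "i < m" "w i < w (Suc i)"
    and unique: "\<And>j. 1 \<le> j \<Longrightarrow> j < m \<Longrightarrow> w j < w (Suc j) \<Longrightarrow> j = i"
  shows "schubert_poly m w f \<longleftrightarrow>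
           (\<exists>g. schubert_poly m (w \<circ> transpose i (Suc i)) g \<and> f = divdiff i g)"
proof
  assume "schubert_poly m w f"
  then show "\<exists>g. schubert_poly m (w \<circ> transpose i (Suc i)) g \<and> f = divdiff i g"
  proof cases
    case longest
    then show ?thesis using i by (auto simp: longest_perm_def)
  next
    case (ascent j g)
    then show ?thesis using unique[of j] by blast
  qed
qed (use w i schubert_poly.ascent in blast)

lemma lt4_cases: "1 \<le> j \<Longrightarrow> j < 4 \<Longrightarrow> j = 1 \<or> j = 2 \<or> j = (3::nat)"
  by auto

lemma one_line4:
  "one_line [a, b, c, d] j =
     (if j = 1 then a else if j = 2 then b else if j = 3 then c else if j = 4 then d else j)"
proof -
  have "j = 0 \<or> j = 1 \<or> j = 2 \<or> j = 3 \<or> j = 4 \<or> j > 4" by auto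
  then show ?thesis by (auto simp: one_line_def)
qed

lemma one_line4_permutes:
  assumes "distinct [a, b, c, d]" "{a, b, c, d} = {1..4}"
  shows "one_line [a, b, c, d] permutes {1..4}"
proof (rule bij_imp_permutes)
  have "{1..4::nat} = {1, 2, 3, 4}" by auto
  then show "bij_betw (one_line [a, b, c, d]) {1..4} {1..4}"
    using assms by (auto simp: bij_betw_def inj_on_def one_line4)
qed (auto simp: one_line4)

lemma atLeastAtMost_1_4: "{1..4::nat} = {1, 2, 3, 4}"
  by auto

lemma schubert_poly_4132:
  "schubert_poly 4 (one_line [4, 1, 3, 2]) f \<longleftrightarrow> f = X 1 ^ 3 * (X 2 + X 3)"
proof -
  have top: "one_line [4, 3, 2, 1] = longest_perm 4"
    by (rule ext) (auto simp: one_line4 longest_perm_def)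
  have p1: "one_line [4, 3, 1, 2] permutes {1..4}"
    by (rule one_line4_permutes) auto
  have p2: "one_line [4, 1, 3, 2] permutes {1..4}"
    by (rule one_line4_permutes) auto
  have d1: "divdiff 3 (X 1 ^ 3 * X 2 ^ 2 * X 3) = X 1 ^ 3 * X 2 ^ 2"
    by (rule divdiff_eqI)
       (simp add: swap_vars_def poly_subst_mult poly_subst_power transpose_def algebra_simps)
  have d2: "divdiff 2 (X 1 ^ 3 * X 2 ^ 2) = X 1 ^ 3 * (X 2 + X 3)"
    by (rule divdiff_eqI)
       (simp add: swap_vars_def poly_subst_mult poly_subst_power transpose_def algebra_simps
          power2_eq_square)
  have s1: "one_line [4, 3, 1, 2] \<circ> transpose 3 (Suc 3) = longest_perm 4"
    unfolding top[symmetric] by (rule ext) (auto simp: one_line4 transpose_def)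
  have s2: "one_line [4, 1, 3, 2] \<circ> transpose 2 (Suc 2) = one_line [4, 3, 1, 2]"
    by (rule ext) (auto simp: one_line4 transpose_def)
  have f0: "schubert_poly 4 (longest_perm 4) g \<longleftrightarrow> g = X 1 ^ 3 * X 2 ^ 2 * X 3" for g
    unfolding schubert_poly_longest_iff atLeastAtMost_1_4 by (simp add: mult.assoc)
  have "schubert_poly 4 (one_line [4, 3, 1, 2]) g \<longleftrightarrow>
      (\<exists>h. schubert_poly 4 (one_line [4, 3, 1, 2] \<circ> transpose 3 (Suc 3)) h \<and> g = divdiff 3 h)" for g
    by (rule schubert_poly_unique_ascent_iff[OF p1])
       (auto simp: one_line4 split: if_splits dest: lt4_cases)
  then have f1: "schubert_poly 4 (one_line [4, 3, 1, 2]) g \<longleftrightarrow> g = X 1 ^ 3 * X 2 ^ 2" for g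
    unfolding s1 f0 by (simp add: d1 del: One_nat_def)
  have "schubert_poly 4 (one_line [4, 1, 3, 2]) f \<longleftrightarrow>
      (\<exists>h. schubert_poly 4 (one_line [4, 1, 3, 2] \<circ> transpose 2 (Suc 2)) h \<and> f = divdiff 2 h)"
    by (rule schubert_poly_unique_ascent_iff[OF p2])
       (auto simp: one_line4 split: if_splits dest: lt4_cases)
  then show ?thesis
    unfolding s2 f1 by (simp add: d2 del: One_nat_def)
qed

lemma schubert_poly_1432:
  "schubert_poly 4 (one_line [1, 4, 3, 2]) f \<longleftrightarrow>
     f = X 1 ^ 2 * X 2 + X 1 ^ 2 * X 3 + X 1 * X 2 ^ 2 + X 1 * X 2 * X 3 + X 2 ^ 2 * X 3"
proof -
  have p: "one_line [1, 4, 3, 2] permutes {1..4}"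
    by (rule one_line4_permutes) auto
  have s: "one_line [1, 4, 3, 2] \<circ> transpose 1 (Suc 1) = one_line [4, 1, 3, 2]"
    by (rule ext) (auto simp: one_line4 transpose_def)
  have d: "divdiff 1 (X 1 ^ 3 * (X 2 + X 3)) =
      X 1 ^ 2 * X 2 + X 1 ^ 2 * X 3 + X 1 * X 2 ^ 2 + X 1 * X 2 * X 3 + X 2 ^ 2 * X 3"
    by (rule divdiff_eqI)
       (simp add: swap_vars_def poly_subst_mult poly_subst_power poly_subst_add transpose_def
          algebra_simps numeral_2_eq_2 numeral_3_eq_3)
  have "schubert_poly 4 (one_line [1, 4, 3, 2]) f \<longleftrightarrow>
      (\<exists>h. schubert_poly 4 (one_line [1, 4, 3, 2] \<circ> transpose 1 (Suc 1)) h \<and> f = divdiff 1 h)"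
    by (rule schubert_poly_unique_ascent_iff[OF p])
       (auto simp: one_line4 split: if_splits dest: lt4_cases)
  then show ?thesis
    unfolding s schubert_poly_4132 by (simp add: d del: One_nat_def)
qed

end

(* A divided difference of a Schubert polynomial is zero or a Schubert polynomial, a Schubert
   polynomial killed by all of them is 1, and a nonzero divided difference determines the Schubert
   polynomial it comes from.  The composite of the divided differences k, ..., k+D-1 extracts the
   coefficient of x_k^D from a polynomial of degree at most D in x_k and free of later variables.
   Hence, if x^mu S_1432(x^{-1}) were a Schubert polynomial, removing x_4, ..., x_n would leave one
   of the form f = x_1^A x_2^B x_3^C (x_1^2 + x_1 x_2 + x_2^2 + x_1 x_3 + x_2 x_3), and extracting
   its top power of x_3 gives x_1^A x_2^B (x_1 + x_2).  If A < B, or A = B <= C, further divided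
   differences lead to -1.  If A > B, or A = B > C, some chain of divided differences agrees on f
   (or on x_1^A x_2^B (x_1 + x_2)) and on a different Schubert polynomial obtained from a dominant
   monomial. *)
theory Submission
  imports Defs
begin

section \<open>Divided differences\<close>

lemma of_int_eq_single: "(of_int c :: 'a::monoid_add \<Rightarrow>\<^sub>0 int) = Poly_Mapping.single 0 c"
  by (rule poly_mapping_eqI) (simp add: lookup_of_int lookup_single)

lemma poly_subst_of_int [simp]: "poly_subst \<sigma> (of_int c) = of_int c"
  by (subst of_int_eq_single) (simp add: poly_subst_single monom_subst_def)

lemma monom_subst_X: "monom_subst X a = Poly_Mapping.single a 1"
proof -
  have pow: "X i ^ k = Poly_Mapping.single (Poly_Mapping.single i k) 1" for i k
    by (induction k) (simp_all add: X_def mult_single flip: single_add)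
  have prod: "(\<Prod>i\<in>A. Poly_Mapping.single (g i) (1::int)) = Poly_Mapping.single (\<Sum>i\<in>A. g i) 1"
    if "finite A" for A :: "nat set" and g :: "nat \<Rightarrow> nat \<Rightarrow>\<^sub>0 nat"
    using that by (induction A rule: finite_induct) (simp_all add: mult_single)
  show ?thesis
    by (simp add: monom_subst_def pow prod flip: sum_singles)
qed

text \<open>Integer constants and variables generate the polynomial ring, so an identity between
  homomorphisms, or a divisibility that passes to sums and products, need only be checked on
  generators.\<close>

lemma zpoly_induct [case_names of_int X add mult]:
  assumes "\<And>c. P (of_int c)" "\<And>i. P (X i)"
    and "\<And>f g. P f \<Longrightarrow> P g \<Longrightarrow> P (f + g)"
    and "\<And>f g. P f \<Longrightarrow> P g \<Longrightarrow> P (f * g)"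
  shows "P (f :: zpoly)"
proof -
  have 0: "P 0" and 1: "P 1"
    using assms(1)[of 0] assms(1)[of 1] by simp_all
  have power: "P (X i ^ k)" for i k
    by (induction k) (simp_all add: 1 assms)
  have prod: "P (\<Prod>i\<in>A. X i ^ k i)" for A k
    by (induction A rule: infinite_finite_induct) (simp_all add: 1 assms power)
  have sum: "P (\<Sum>a\<in>A. g a)" if "\<And>a. P (g a)" for A and g :: "(nat \<Rightarrow>\<^sub>0 nat) \<Rightarrow> zpoly"
    by (induction A rule: infinite_finite_induct) (simp_all add: 0 assms that)
  have "f = (\<Sum>a\<in>Poly_Mapping.keys f. of_int (Poly_Mapping.lookup f a) * monom_subst X a)"
    using sum_singles[of f] by (simp add: of_int_eq_single monom_subst_X mult_single)
  moreover have "P (of_int c * monom_subst X a)" for c a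
    unfolding monom_subst_def by (intro assms prod)
  ultimately show ?thesis
    by (metis (no_types, lifting) sum)
qed

lemma poly_subst_minus: "poly_subst \<sigma> (- f) = - poly_subst \<sigma> f"
  using poly_subst_add[of \<sigma> f "- f"] by (simp add: eq_neg_iff_add_eq_0 add.commute)

lemma poly_subst_diff: "poly_subst \<sigma> (f - g) = poly_subst \<sigma> f - poly_subst \<sigma> g"
  using poly_subst_add[of \<sigma> f "- g"] by (simp add: poly_subst_minus)

lemma poly_subst_prod: "poly_subst \<sigma> (\<Prod>i\<in>A. f i) = (\<Prod>i\<in>A. poly_subst \<sigma> (f i))"
  by (induction A rule: infinite_finite_induct) (auto simp: poly_subst_mult)

lemma poly_subst_poly_subst:
  "poly_subst \<sigma> (poly_subst \<tau> f) = poly_subst (\<lambda>i. poly_subst \<sigma> (\<tau> i)) f"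
  by (induction f rule: zpoly_induct) (simp_all add: poly_subst_add poly_subst_mult)

lemma poly_subst_X_id: "poly_subst X f = f"
  by (induction f rule: zpoly_induct) (simp_all add: poly_subst_add poly_subst_mult)

section \<open>The action of adjacent transpositions on polynomials\<close>

lemma swap_vars_add: "swap_vars i (f + g) = swap_vars i f + swap_vars i g"
  and swap_vars_minus: "swap_vars i (- f) = - swap_vars i f"
  and swap_vars_diff: "swap_vars i (f - g) = swap_vars i f - swap_vars i g"
  and swap_vars_mult: "swap_vars i (f * g) = swap_vars i f * swap_vars i g"
  and swap_vars_power: "swap_vars i (f ^ n) = swap_vars i f ^ n"
  and swap_vars_X: "swap_vars i (X j) = X (transpose i (Suc i) j)"
  and swap_vars_0 [simp]: "swap_vars i 0 = 0"
  and swap_vars_1 [simp]: "swap_vars i 1 = 1"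
  by (simp_all add: swap_vars_def poly_subst_add poly_subst_diff poly_subst_minus
      poly_subst_mult poly_subst_power)

lemmas swap_vars_simps =
  swap_vars_add swap_vars_minus swap_vars_diff swap_vars_mult swap_vars_power swap_vars_X

lemma swap_vars_idem [simp]: "swap_vars i (swap_vars i f) = f"
  by (simp add: swap_vars_def poly_subst_poly_subst poly_subst_X_id)

lemma swap_vars_commute:
  assumes "i \<noteq> j" "i \<noteq> Suc j" "j \<noteq> Suc i"
  shows "swap_vars i (swap_vars j f) = swap_vars j (swap_vars i f)"
proof -
  have "transpose i (Suc i) (transpose j (Suc j) k) = transpose j (Suc j) (transpose i (Suc i) k)" for k
    using assms by (auto simp: transpose_def)
  then show ?thesis
    by (simp add: swap_vars_def poly_subst_poly_subst)
qed

lemma swap_vars_braid: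
  "swap_vars i (swap_vars (Suc i) (swap_vars i f)) =
   swap_vars (Suc i) (swap_vars i (swap_vars (Suc i) f))"
proof -
  have "transpose i (Suc i) (transpose (Suc i) (Suc (Suc i)) (transpose i (Suc i) k)) =
     transpose (Suc i) (Suc (Suc i)) (transpose i (Suc i) (transpose (Suc i) (Suc (Suc i)) k))" for k
    by (auto simp: transpose_def)
  then show ?thesis
    by (simp add: swap_vars_def poly_subst_poly_subst)
qed

lemma X_diff_neq_0: "i \<noteq> j \<Longrightarrow> X i - X j \<noteq> 0"
  using X_neq[of i j] by simp

text \<open>The identity f g - s(f g) = (f - s f) g + s f (g - s g) carries divisibility from the
  generators to products. Together with \<open>divdiff_eqI\<close> it makes the description in
  \<open>divdiff\<close> denote a genuine quotient.\<close>

lemma X_diff_dvd_diff_swap_vars: "X i - X (Suc i) dvd f - swap_vars i f"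
proof (induction f rule: zpoly_induct)
  case (of_int c)
  then show ?case by (simp add: swap_vars_def)
next
  case (X j)
  have "X (Suc i) - X i = (X i - X (Suc i)) * (- 1)"
    by simp
  then have "X i - X (Suc i) dvd X (Suc i) - X i"
    by (metis dvd_triv_left)
  then show ?case
    by (auto simp: swap_vars_X transpose_def)
next
  case (add f g)
  have "f + g - swap_vars i (f + g) = (f - swap_vars i f) + (g - swap_vars i g)"
    by (simp add: swap_vars_add)
  with add show ?case
    by (metis dvd_add)
next
  case (mult f g)
  have "f * g - swap_vars i (f * g) = (f - swap_vars i f) * g + swap_vars i f * (g - swap_vars i g)"
    by (simp add: swap_vars_mult algebra_simps)
  with mult show ?case
    by (metis dvd_add dvd_mult dvd_mult2)
qed

section \<open>Calculus of divided differences\<close>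

lemma X_diff_mult_divdiff: "(X i - X (Suc i)) * divdiff i f = f - swap_vars i f"
  using X_diff_dvd_diff_swap_vars[of i f] divdiff_eqI by (metis dvdE)

lemma divdiff_eq_0_iff: "divdiff i f = 0 \<longleftrightarrow> swap_vars i f = f"
  using X_diff_mult_divdiff[of i f] X_diff_neq_0[of i "Suc i"]
  by (metis divdiff_eqI eq_iff_diff_eq_0 mult_zero_right n_not_Suc_n)

lemma divdiff_add: "divdiff i (f + g) = divdiff i f + divdiff i g"
  by (rule divdiff_eqI) (simp add: distrib_left X_diff_mult_divdiff swap_vars_simps)

lemma divdiff_minus: "divdiff i (- f) = - divdiff i f"
  by (rule divdiff_eqI) (simp add: X_diff_mult_divdiff swap_vars_simps)

lemma divdiff_diff: "divdiff i (f - g) = divdiff i f - divdiff i g"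
  by (rule divdiff_eqI) (simp add: right_diff_distrib X_diff_mult_divdiff swap_vars_simps)

lemma divdiff_0 [simp]: "divdiff i 0 = 0" and divdiff_1 [simp]: "divdiff i 1 = 0"
  by (simp_all add: divdiff_eq_0_iff)

lemma divdiff_mult: "divdiff i (f * g) = divdiff i f * g + swap_vars i f * divdiff i g"
proof (rule divdiff_eqI)
  have "(X i - X (Suc i)) * (divdiff i f * g + swap_vars i f * divdiff i g) =
      ((X i - X (Suc i)) * divdiff i f) * g + swap_vars i f * ((X i - X (Suc i)) * divdiff i g)"
    by (simp only: distrib_left mult_ac)
  also have "\<dots> = f * g - swap_vars i (f * g)"
    unfolding X_diff_mult_divdiff by (simp add: swap_vars_mult algebra_simps)
  finally show "(X i - X (Suc i)) * (divdiff i f * g + swap_vars i f * divdiff i g) =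
      f * g - swap_vars i (f * g)" .
qed

lemma divdiff_sym_mult: "divdiff i f = 0 \<Longrightarrow> divdiff i (f * g) = f * divdiff i g"
  by (simp add: divdiff_mult divdiff_eq_0_iff)

lemma divdiff_sym_mult_eq_0: "divdiff i f = 0 \<Longrightarrow> divdiff i g = 0 \<Longrightarrow> divdiff i (f * g) = 0"
  by (simp add: divdiff_sym_mult)

lemma divdiff_sym_power_eq_0: "divdiff i f = 0 \<Longrightarrow> divdiff i (f ^ n) = 0"
  by (simp add: divdiff_eq_0_iff swap_vars_power)

lemma divdiff_X_other: "j \<noteq> i \<Longrightarrow> j \<noteq> Suc i \<Longrightarrow> divdiff i (X j) = 0"
  by (simp add: divdiff_eq_0_iff swap_vars_X transpose_def)

lemma divdiff_X_same: "divdiff i (X i) = 1"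
  by (rule divdiff_eqI) (simp add: swap_vars_X)

lemma divdiff_X_mult: "divdiff i (X i * f) = f + X (Suc i) * divdiff i f"
  by (simp add: divdiff_mult divdiff_X_same swap_vars_X)

text \<open>Under s_i the numerator and the denominator of the quotient both change sign, so the
  quotient is invariant.\<close>

lemma divdiff_divdiff [simp]: "divdiff i (divdiff i f) = 0"
proof -
  have "(X i - X (Suc i)) * swap_vars i (divdiff i f) = f - swap_vars i f"
    using arg_cong[OF X_diff_mult_divdiff[of i f], of "swap_vars i"]
    by (simp add: swap_vars_simps algebra_simps)
  then show ?thesis
    using X_diff_mult_divdiff[of i f] X_diff_neq_0[of i "Suc i"]
    by (metis divdiff_eqI divdiff_eq_0_iff)
qed

lemma swap_vars_divdiff_commute:
  assumes "i \<noteq> j" "i \<noteq> Suc j" "j \<noteq> Suc i"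
  shows "swap_vars i (divdiff j f) = divdiff j (swap_vars i f)"
proof (rule sym, rule divdiff_eqI)
  show "(X j - X (Suc j)) * swap_vars i (divdiff j f) = swap_vars i f - swap_vars j (swap_vars i f)"
    using arg_cong[OF X_diff_mult_divdiff[of j f], of "swap_vars i"] assms
    by (simp add: swap_vars_simps transpose_def swap_vars_commute[of i j])
qed

lemma divdiff_commute:
  assumes "i \<noteq> j" "i \<noteq> Suc j" "j \<noteq> Suc i"
  shows "divdiff i (divdiff j f) = divdiff j (divdiff i f)"
proof (rule divdiff_eqI)
  have "divdiff j (X i - X (Suc i)) = 0"
    using assms by (simp add: divdiff_eq_0_iff swap_vars_simps transpose_def)
  then have "(X i - X (Suc i)) * divdiff j (divdiff i f) = divdiff j (f - swap_vars i f)"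
    by (simp add: X_diff_mult_divdiff flip: divdiff_sym_mult)
  then show "(X i - X (Suc i)) * divdiff j (divdiff i f) = divdiff j f - swap_vars i (divdiff j f)"
    by (simp add: divdiff_diff swap_vars_divdiff_commute assms)
qed

text \<open>Multiplied by the Vandermonde product \<open>?V\<close>, each side becomes the
  alternating sum of f over the copy of S_3 generated by s_i and s_(i+1); the two sums agree by
  \<open>swap_vars_braid\<close>.\<close>

lemma divdiff_braid:
  "divdiff i (divdiff (Suc i) (divdiff i f)) = divdiff (Suc i) (divdiff i (divdiff (Suc i) f))"
proof -
  define s t where "s = swap_vars i" and "t = swap_vars (Suc i)"
  define x y z where "x = X i" and "y = X (Suc i)" and "z = X (Suc (Suc i))"
  have sx: "s x = y" "s y = x" "s z = z" and tx: "t x = x" "t y = z" "t z = y"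
    by (simp_all add: s_def t_def x_def y_def z_def swap_vars_X transpose_def)
  have sm: "s (f * g) = s f * s g" "s (f - g) = s f - s g"
    and tm: "t (f * g) = t f * t g" "t (f - g) = t f - t g" for f g
    by (simp_all add: s_def t_def swap_vars_simps)
  have ss: "s (s f) = f" and tt: "t (t f) = f" for f
    by (simp_all add: s_def t_def)
  have nz: "x - y \<noteq> 0" "x - z \<noteq> 0" "y - z \<noteq> 0"
    by (simp_all add: x_def y_def z_def X_diff_neq_0 del: right_minus_eq)
  have ds: "(x - y) * divdiff i g = g - s g"
    and dt: "(y - z) * divdiff (Suc i) g = g - t g" for g
    using X_diff_mult_divdiff[of i g] X_diff_mult_divdiff[of "Suc i" g]
    by (simp_all add: x_def y_def z_def s_def t_def)
  let ?V = "(x - y) * (x - z) * (y - z)"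
  have L: "?V * divdiff i (divdiff (Suc i) (divdiff i f)) =
      f - s f - t f + t (s f) + s (t f) - s (t (s f))"
  proof -
    define a where "a = divdiff i f"
    define b where "b = divdiff (Suc i) a"
    define c where "c = divdiff i b"
    have a: "(x - y) * a = f - s f" and b: "(y - z) * b = a - t a" and c: "(x - y) * c = b - s b"
      by (simp_all add: a_def b_def c_def ds dt)
    have ta: "(x - z) * t a = t f - t (s f)"
      using arg_cong[OF a, of t] by (simp add: tm tx)
    have sb: "(x - z) * s b = s a - s (t a)"
      using arg_cong[OF b, of s] by (simp add: sm sx)
    have sa: "(y - x) * s a = s f - f"
      using arg_cong[OF a, of s] by (simp add: sm sx ss)
    have sta: "(y - z) * s (t a) = s (t f) - s (t (s f))"
      using arg_cong[OF ta, of s] by (simp add: sm sx)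
    \<comment> \<open>After \<open>b\<close> and \<open>c\<close> are eliminated, terms in
      \<open>a\<close> and \<open>s a\<close> remain. The extra factor x - y clears their
      denominator and is cancelled afterwards.\<close>
    have "(x - y) * (?V * c) = (x - y) * (f - s f - t f + t (s f) + s (t f) - s (t (s f)))"
      using a b c ta sb sa sta by algebra
    then show ?thesis
      using nz unfolding c_def b_def a_def by simp
  qed
  have R: "?V * divdiff (Suc i) (divdiff i (divdiff (Suc i) f)) =
      f - t f - s f + s (t f) + t (s f) - t (s (t f))"
  proof -
    define a where "a = divdiff (Suc i) f"
    define b where "b = divdiff i a"
    define c where "c = divdiff (Suc i) b"
    have a: "(y - z) * a = f - t f" and b: "(x - y) * b = a - s a" and c: "(y - z) * c = b - t b"
      by (simp_all add: a_def b_def c_def ds dt)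
    have sa: "(x - z) * s a = s f - s (t f)"
      using arg_cong[OF a, of s] by (simp add: sm sx)
    have tb: "(x - z) * t b = t a - t (s a)"
      using arg_cong[OF b, of t] by (simp add: tm tx)
    have ta: "(z - y) * t a = t f - f"
      using arg_cong[OF a, of t] by (simp add: tm tx tt)
    have tsa: "(x - y) * t (s a) = t (s f) - t (s (t f))"
      using arg_cong[OF sa, of t] by (simp add: tm tx)
    have "(y - z) * (?V * c) = (y - z) * (f - t f - s f + s (t f) + t (s f) - t (s (t f)))"
      using a b c ta tb sa tsa by algebra
    then show ?thesis
      using nz unfolding c_def b_def a_def by simp
  qed
  have "s (t (s f)) = t (s (t f))"
    by (simp add: s_def t_def swap_vars_braid)
  with L R have "?V * divdiff i (divdiff (Suc i) (divdiff i f)) =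
      ?V * divdiff (Suc i) (divdiff i (divdiff (Suc i) f))"
    by simp
  then show ?thesis
    using nz by simp
qed

section \<open>Well-definedness of Schubert polynomials\<close>

text \<open>An induction measure in place of the length: turning an ascent into a descent lowers it.
  It serves inductions towards the longest element, and its distance from an upper bound serves
  those towards the identity.\<close>

definition perm_weight :: "nat \<Rightarrow> (nat \<Rightarrow> nat) \<Rightarrow> nat" where
  "perm_weight m w = (\<Sum>i\<in>{1..m}. i * w i)"

lemma perm_weight_transpose:
  assumes "1 \<le> i" "i < m" "w i < w (Suc i)"
  shows "perm_weight m (w \<circ> transpose i (Suc i)) < perm_weight m w"
proof -
  let ?v = "w \<circ> transpose i (Suc i)"
  let ?R = "{1..m} - {i, Suc i}"
  have R: "{1..m} = insert i (insert (Suc i) ?R)"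
    using assms by auto
  have split: "(\<Sum>j\<in>{1..m}. j * h j) = i * h i + Suc i * h (Suc i) + (\<Sum>j\<in>?R. j * h j)"
    for h :: "nat \<Rightarrow> nat"
    by (subst R) simp
  have "(\<Sum>j\<in>?R. j * ?v j) = (\<Sum>j\<in>?R. j * w j)"
    by (rule sum.cong) (auto simp: transpose_def)
  moreover have "i * w (Suc i) + Suc i * w i < i * w i + Suc i * w (Suc i)"
    using assms by simp
  ultimately show ?thesis
    unfolding perm_weight_def split by simp
qed

lemma perm_weight_le:
  assumes "w permutes {1..m}"
  shows "perm_weight m w \<le> m * (m * m)"
proof -
  have "i * w i \<le> m * m" if "i \<in> {1..m}" for i
    using that permutes_in_image[OF assms, of i] by (intro mult_mono) auto
  then have "perm_weight m w \<le> of_nat (card {1..m}) * (m * m)"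
    unfolding perm_weight_def by (intro sum_bounded_above)
  then show ?thesis by simp
qed

lemma permutes_comp_transpose_Suc:
  "w permutes {1..m} \<Longrightarrow> 1 \<le> i \<Longrightarrow> i < m \<Longrightarrow> (w \<circ> transpose i (Suc i)) permutes {1..m}"
  by (intro permutes_compose[OF permutes_swap_id]) auto

lemma comp_transpose_transpose: "w \<circ> transpose i j \<circ> transpose i j = w"
  by (simp add: fun_eq_iff)

lemma permutes_ascent_or_descent:
  assumes "w permutes {1..m}"
  shows "w i < w (Suc i) \<or> w (Suc i) < w i"
  using permutes_inj[OF assms] by (metis injD linorder_neqE_nat n_not_Suc_n)

lemma longest_perm_permutes: "longest_perm m permutes {1..m}"
proof (rule bij_imp_permutes)
  show "bij_betw (longest_perm m) {1..m} {1..m}"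
    by (rule bij_betwI[of _ _ _ "longest_perm m"]) (auto simp: longest_perm_def)
qed (auto simp: longest_perm_def)

text \<open>Composing with the longest element on the left reverses all comparisons and reduces this
  to \<open>no_ascent_imp_longest\<close>.\<close>

lemma no_descent_imp_id:
  assumes w: "w permutes {1..m}" and asc: "\<And>i. 1 \<le> i \<Longrightarrow> i < m \<Longrightarrow> w i < w (Suc i)"
  shows "w = id"
proof -
  have "longest_perm m \<circ> w = longest_perm m"
  proof (rule no_ascent_imp_longest)
    show "(longest_perm m \<circ> w) permutes {1..m}"
      by (rule permutes_compose[OF w longest_perm_permutes])
    fix i assume i: "1 \<le> i" "i < m"
    then have "w i \<in> {1..m}" "w (Suc i) \<in> {1..m}"
      using permutes_in_image[OF w] by auto
    then show "(longest_perm m \<circ> w) (Suc i) < (longest_perm m \<circ> w) i"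
      using asc[OF i] by (auto simp: longest_perm_def)
  qed
  then show ?thesis
    using permutes_inj[OF longest_perm_permutes[of m]] by (metis comp_id fun.inj_map injD)
qed

section \<open>Independence of the chosen ascents\<close>

lemma schubert_poly_permutes: "schubert_poly m w f \<Longrightarrow> w permutes {1..m}"
  by (induction rule: schubert_poly.induct) (simp_all only: longest_perm_permutes)

text \<open>A diamond argument: two derivations that start with different ascents are joined at a
  common permutation further up, where commutation or the braid relation makes the results
  equal.\<close>

lemma schubert_poly_unique:
  assumes "schubert_poly m w f" "schubert_poly m w g"
  shows "f = g"
  using assms
proof (induction "perm_weight m w" arbitrary: w f g rule: less_induct)
  case less
  note w = schubert_poly_permutes[OF less.prems(1)]
  have confluent: "divdiff i f' = divdiff j g'"
    if i: "1 \<le> i" "i < m" "w i < w (Suc i)" and j: "j < m" "w j < w (Suc j)" and ij: "i < j"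
      and f': "schubert_poly m (w \<circ> transpose i (Suc i)) f'"
      and g': "schubert_poly m (w \<circ> transpose j (Suc j)) g'" for i j f' g'
  proof -
    have j1: "1 \<le> j" using i ij by simp
    \<comment> \<open>The permutations one step away have smaller weight, so by induction
      \<open>f'\<close> and \<open>g'\<close> may be recomputed along any convenient route.\<close>
    have eq_f': "f' = f''" if "schubert_poly m (w \<circ> transpose i (Suc i)) f''" for f''
      using less.hyps[OF perm_weight_transpose] i f' that by blast
    have eq_g': "g' = g''" if "schubert_poly m (w \<circ> transpose j (Suc j)) g''" for g''
      using less.hyps[OF perm_weight_transpose] j1 j g' that by blast
    note perms = permutes_comp_transpose_Suc
    show ?thesis
    proof (cases "j = Suc i")
      case False
      \<comment> \<open>The ascents do not overlap, and both routes pass through w s_i s_j = w s_j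
        s_i.\<close>
      let ?v = "w \<circ> transpose i (Suc i) \<circ> transpose j (Suc j)"
      have v: "?v = w \<circ> transpose j (Suc j) \<circ> transpose i (Suc i)"
        using ij False by (auto simp: fun_eq_iff transpose_def)
      have "?v permutes {1..m}"
        using i j j1 w by (intro perms)
      then obtain h where h: "schubert_poly m ?v h"
        using schubert_poly_exists by blast
      have "schubert_poly m (w \<circ> transpose i (Suc i)) (divdiff j h)"
        using h i j j1 ij False by (intro schubert_poly.ascent perms w) (auto simp: transpose_def)
      moreover have "schubert_poly m (w \<circ> transpose j (Suc j)) (divdiff i h)"
        using h[unfolded v] i j j1 ij False
        by (intro schubert_poly.ascent perms w) (auto simp: transpose_def)
      ultimately show ?thesis
        using eq_f' eq_g' divdiff_commute[of i j h] ij False by simp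
    next
      case True
      \<comment> \<open>Here w increases on three consecutive positions; both routes meet at the
        permutation with this triple reversed.\<close>
      let ?v = "w \<circ> transpose i (Suc i) \<circ> transpose j (Suc j) \<circ> transpose i (Suc i)"
      have v: "?v = w \<circ> transpose j (Suc j) \<circ> transpose i (Suc i) \<circ> transpose j (Suc j)"
        using True by (auto simp: fun_eq_iff transpose_def)
      have "?v permutes {1..m}"
        using i j j1 w by (intro perms)
      then obtain h where h: "schubert_poly m ?v h"
        using schubert_poly_exists by blast
      have "schubert_poly m (w \<circ> transpose i (Suc i) \<circ> transpose j (Suc j)) (divdiff i h)"
        using h i j j1 True by (intro schubert_poly.ascent perms w) (auto simp: transpose_def)
      then have "schubert_poly m (w \<circ> transpose i (Suc i)) (divdiff j (divdiff i h))"
        using h i j j1 True by (intro schubert_poly.ascent perms w) (auto simp: transpose_def)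
      moreover have "schubert_poly m (w \<circ> transpose j (Suc j) \<circ> transpose i (Suc i)) (divdiff j h)"
        using h[unfolded v] i j j1 True
        by (intro schubert_poly.ascent perms w) (auto simp: transpose_def)
      then have "schubert_poly m (w \<circ> transpose j (Suc j)) (divdiff i (divdiff j h))"
        using h[unfolded v] i j j1 True by (intro schubert_poly.ascent perms w) (auto simp: transpose_def)
      ultimately show ?thesis
        using eq_f' eq_g' divdiff_braid[of i h] True by simp
    qed
  qed
  from less.prems(1) show ?case
  proof cases
    case longest
    then show ?thesis
      using less.prems(2) schubert_poly_longest_iff by metis
  next
    case f: (ascent i f')
    from less.prems(2) show ?thesis
    proof cases
      case longest
      then show ?thesis
        using less.prems(1) schubert_poly_longest_iff by metis
    next
      case g: (ascent j g')
      consider "i < j" | "j < i" | "i = j"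
        by linarith
      then show ?thesis
      proof cases
        case 1
        then show ?thesis using confluent f g by blast
      next
        case 2
        then show ?thesis using confluent f g by metis
      next
        case 3
        then have "f' = g'"
          using less.hyps[OF perm_weight_transpose] f g by blast
        with 3 f g show ?thesis by simp
      qed
    qed
  qed
qed

text \<open>By uniqueness f is itself of the form \<open>divdiff i g\<close>, and divided
  differences square to zero.\<close>

lemma schubert_poly_ascent_divdiff:
  assumes f: "schubert_poly m w f" and i: "1 \<le> i" "i < m" "w i < w (Suc i)"
  shows "divdiff i f = 0"
proof -
  note w = schubert_poly_permutes[OF f]
  obtain g where g: "schubert_poly m (w \<circ> transpose i (Suc i)) g"
    using schubert_poly_exists permutes_comp_transpose_Suc w i by blast
  then have "f = divdiff i g"
    using schubert_poly_unique[OF f] schubert_poly.ascent w i by blast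
  then show ?thesis by simp
qed

lemma schubert_poly_descent_divdiff:
  assumes f: "schubert_poly m w f" and i: "1 \<le> i" "i < m" "w (Suc i) < w i"
  shows "schubert_poly m (w \<circ> transpose i (Suc i)) (divdiff i f)"
  using assms schubert_poly_permutes[OF f]
  by (intro schubert_poly.ascent permutes_comp_transpose_Suc) (simp_all add: comp_transpose_transpose)

lemma swap_vars_monomial:
  assumes "finite A" "i \<in> A" "Suc i \<in> A" "e i = e (Suc i)"
  shows "swap_vars i (\<Prod>j\<in>A. X j ^ e j) = (\<Prod>j\<in>A. X j ^ e j)"
proof -
  have "swap_vars i (\<Prod>j\<in>A. X j ^ e j) = (\<Prod>j\<in>A. X (transpose i (Suc i) j) ^ e j)"
    by (simp add: swap_vars_def poly_subst_prod poly_subst_power)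
  also have "\<dots> = (\<Prod>j\<in>A. X (transpose i (Suc i) j) ^ e (transpose i (Suc i) j))"
    using assms by (intro prod.cong) (auto simp: transpose_def)
  also have "\<dots> = (\<Prod>j\<in>transpose i (Suc i) ` A. X j ^ e j)"
    by (subst prod.reindex) simp_all
  also have "transpose i (Suc i) ` A = A"
    using assms by simp
  finally show ?thesis .
qed

text \<open>Stability under appending a fixed point. Only the starting monomial needs work; the
  recursive steps carry over unchanged.\<close>

lemma schubert_poly_Suc:
  assumes "schubert_poly m w f"
  shows "schubert_poly (Suc m) w f"
  using assms
proof (induction rule: schubert_poly.induct)
  case longest
  \<comment> \<open>The permutation m, m-1, ..., 1, m+1 is the longest one of S_(m+1) times s_1 s_2 ... s_m.\<close>
  define w where "w = (\<lambda>k i. if i \<in> {1..Suc m} then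
    if i \<le> k then Suc m - i else if i = Suc k then Suc m else Suc (Suc m) - i else i)"
  define p where "p = (\<lambda>k. \<Prod>i\<in>{1..Suc m}. X i ^ (if i \<le> k then m - i else Suc m - i))"
  have "schubert_poly (Suc m) (w k) (p k)" if "k \<le> m" for k
    using that
  proof (induction k)
    case 0
    have "w 0 = longest_perm (Suc m)"
      by (auto simp: w_def longest_perm_def fun_eq_iff)
    moreover have "p 0 = (\<Prod>i\<in>{1..Suc m}. X i ^ (Suc m - i))"
      unfolding p_def by (intro prod.cong) auto
    ultimately show ?case
      by (simp only: schubert_poly.longest)
  next
    case (Suc k)
    have w: "w (Suc k) \<circ> transpose (Suc k) (Suc (Suc k)) = w k"
      using Suc.prems by (auto simp: w_def fun_eq_iff transpose_def)
    have "w k permutes {1..Suc m}"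
      using Suc.prems by (intro schubert_poly_permutes[OF Suc.IH]) simp
    then have perm: "w (Suc k) permutes {1..Suc m}"
      using permutes_comp_transpose_Suc[of "w k" "Suc m" "Suc k"] Suc.prems
      by (simp add: comp_transpose_transpose flip: w)
    have "schubert_poly (Suc m) (w (Suc k)) (divdiff (Suc k) (p k))"
      using Suc perm w by (intro schubert_poly.ascent) (auto simp: w_def)
    \<comment> \<open>In \<open>p (Suc k)\<close> the variables x_(k+1) and x_(k+2) both have
      exponent m - (k+1), so it is invariant under their exchange, and \<open>p k\<close> is x_(k+1)
      times it.\<close>
    moreover have "divdiff (Suc k) (p k) = p (Suc k)"
    proof -
      have "swap_vars (Suc k) (p (Suc k)) = p (Suc k)"
        unfolding p_def using Suc.prems by (intro swap_vars_monomial) auto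
      then have "divdiff (Suc k) (X (Suc k) * p (Suc k)) = p (Suc k)"
        by (simp add: divdiff_X_mult divdiff_eq_0_iff[THEN iffD2])
      moreover have "p k = X (Suc k) * p (Suc k)"
      proof -
        have "Suc k \<in> {1..Suc m}" using Suc.prems by simp
        then have "(\<Prod>i\<in>{1..Suc m}. X i ^ g i) = X (Suc k) ^ g (Suc k) *
            (\<Prod>i\<in>{1..Suc m} - {Suc k}. X i ^ g i)" for g
          by (intro prod.remove) auto
        note split = this
        have "m - k = Suc (m - Suc k)" using Suc.prems by simp
        moreover have "(\<Prod>i\<in>{1..Suc m} - {Suc k}. X i ^ (if i \<le> k then m - i else Suc m - i)) =
            (\<Prod>i\<in>{1..Suc m} - {Suc k}. X i ^ (if i \<le> Suc k then m - i else Suc m - i))"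
          by (intro prod.cong) auto
        ultimately show ?thesis
          unfolding p_def split by (simp add: mult.assoc)
      qed
      ultimately show ?thesis by simp
    qed
    ultimately show ?case by simp
  qed
  from this[of m] have "schubert_poly (Suc m) (w m) (p m)" by simp
  moreover have "w m = longest_perm m"
    by (auto simp: w_def longest_perm_def fun_eq_iff)
  moreover have "p m = (\<Prod>i\<in>{1..m}. X i ^ (m - i))"
    by (simp add: p_def)
  ultimately show ?case by simp
next
  case (ascent w i f)
  have "w permutes {1..Suc m}"
    by (rule permutes_subset[OF ascent.hyps(1)]) auto
  with ascent show ?case
    by (intro schubert_poly.ascent) (auto simp: comp_def)
qed

lemma schubert_poly_mono: "schubert_poly m w f \<Longrightarrow> m \<le> m' \<Longrightarrow> schubert_poly m' w f"
  by (rotate_tac, induction m' rule: dec_induct) (simp_all add: schubert_poly_Suc)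

lemma schubert_poly_id: "schubert_poly m id f \<longleftrightarrow> f = 1"
proof -
  have "longest_perm 0 = id"
    by (auto simp: longest_perm_def)
  then have "schubert_poly m id 1"
    using schubert_poly.longest[of 0] schubert_poly_mono[of 0 id 1 m] by simp
  then show ?thesis
    using schubert_poly_unique by blast
qed

text \<open>Undoing descents raises the weight, which is bounded by \<open>perm_weight_le\<close>,
  and the process can only stop at the identity.\<close>

lemma schubert_poly_induct_descent [consumes 1, case_names id descent]:
  assumes "schubert_poly m w f"
    and "P id 1"
    and "\<And>w f i. schubert_poly m w f \<Longrightarrow> 1 \<le> i \<Longrightarrow> i < m \<Longrightarrow> w (Suc i) < w i \<Longrightarrow>
      P (w \<circ> transpose i (Suc i)) (divdiff i f) \<Longrightarrow> P w f"
  shows "P w f"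
  using assms(1)
proof (induction "m * (m * m) - perm_weight m w" arbitrary: w f rule: less_induct)
  case less
  note w = schubert_poly_permutes[OF less.prems]
  show ?case
  proof (cases "\<exists>i. 1 \<le> i \<and> i < m \<and> w (Suc i) < w i")
    case True
    then obtain i where i: "1 \<le> i" "i < m" "w (Suc i) < w i" by blast
    let ?v = "w \<circ> transpose i (Suc i)"
    have v: "schubert_poly m ?v (divdiff i f)"
      using schubert_poly_descent_divdiff less.prems i by blast
    have "perm_weight m w < perm_weight m ?v"
      using perm_weight_transpose[of i m ?v] i by (simp add: comp_transpose_transpose)
    then have "m * (m * m) - perm_weight m ?v < m * (m * m) - perm_weight m w"
      using perm_weight_le[OF schubert_poly_permutes[OF v]] by linarith
    then show ?thesis
      using less.hyps v assms(3)[OF less.prems i] by blast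
  next
    case False
    then have "w = id"
      using no_descent_imp_id[OF w] permutes_ascent_or_descent[OF w] by blast
    then show ?thesis
      using less.prems schubert_poly_id assms(2) by simp
  qed
qed

section \<open>Recovering the permutation from its polynomial\<close>

lemma schubert_poly_nonzero: "schubert_poly m w f \<Longrightarrow> f \<noteq> 0"
  by (induction rule: schubert_poly_induct_descent) auto

text \<open>At an ascent the divided difference vanishes; at a descent it is again a Schubert
  polynomial, hence nonzero. The descents can thus be read off the polynomial alone.\<close>

lemma schubert_poly_descent_iff:
  assumes "schubert_poly m w f" "1 \<le> i" "i < m"
  shows "w (Suc i) < w i \<longleftrightarrow> divdiff i f \<noteq> 0"
  using assms schubert_poly_ascent_divdiff schubert_poly_nonzero schubert_poly_descent_divdiff
    permutes_ascent_or_descent[OF schubert_poly_permutes[OF assms(1)]]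
  by (metis order.asym)

text \<open>Both permutations have the same descents; undoing a common one leads to the induction
  hypothesis.\<close>

lemma schubert_poly_inj:
  assumes "schubert_poly m w f" "schubert_poly m v f"
  shows "w = v"
  using assms
proof (induction arbitrary: v rule: schubert_poly_induct_descent)
  case id
  have "v i < v (Suc i)" if "1 \<le> i" "i < m" for i
    using schubert_poly_descent_iff[OF id that]
      permutes_ascent_or_descent[OF schubert_poly_permutes[OF id], of i] by auto
  then show ?case
    using no_descent_imp_id schubert_poly_permutes[OF id] by metis
next
  case (descent w f i)
  then have "v (Suc i) < v i"
    using schubert_poly_descent_iff by blast
  then have "w \<circ> transpose i (Suc i) = v \<circ> transpose i (Suc i)"
    using descent schubert_poly_descent_divdiff by blast
  then show ?case
    by (metis comp_transpose_transpose)
qed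

definition schubert :: "zpoly \<Rightarrow> bool" where
  "schubert f \<longleftrightarrow> (\<exists>m w. schubert_poly m w f)"

lemma schubert_1 [simp]: "schubert 1"
  using schubert_poly_id schubert_def by blast

lemma schubert_nonzero: "schubert f \<Longrightarrow> f \<noteq> 0"
  using schubert_poly_nonzero schubert_def by blast

lemma schubert_obtain_large:
  assumes "schubert f"
  obtains m w where "schubert_poly m w f" "k < m"
proof -
  obtain m w where "schubert_poly m w f"
    using assms schubert_def by blast
  then have "schubert_poly (max m (Suc k)) w f"
    by (rule schubert_poly_mono) simp
  then show ?thesis
    by (rule that) simp
qed

lemma schubert_divdiff:
  assumes "schubert f" "1 \<le> i" "divdiff i f \<noteq> 0"
  shows "schubert (divdiff i f)"
proof -
  obtain m w where "schubert_poly m w f" "i < m"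
    using schubert_obtain_large[OF assms(1)] .
  then show ?thesis
    using assms schubert_poly_descent_iff schubert_poly_descent_divdiff schubert_def by metis
qed

text \<open>Nonvanishing makes i a descent of both permutations. The common divided difference
  belongs to both w s_i and v s_i, so these coincide by \<open>schubert_poly_inj\<close>. The group
  is first enlarged to a common \<open>m\<close>.\<close>

lemma schubert_divdiff_cancel:
  assumes f: "schubert f" and g: "schubert g" and i: "1 \<le> i"
    and eq: "divdiff i f = divdiff i g" and nz: "divdiff i f \<noteq> 0"
  shows "f = g"
proof -
  obtain m1 w where w: "schubert_poly m1 w f" "i < m1"
    using schubert_obtain_large[OF f] .
  obtain m v where v: "schubert_poly m v g" "m1 < m"
    using schubert_obtain_large[OF g] .
  have w': "schubert_poly m w f" and im: "i < m"
    using w v schubert_poly_mono[of m1 w f m] by auto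
  then have "w \<circ> transpose i (Suc i) = v \<circ> transpose i (Suc i)"
    using v(1) i eq nz schubert_poly_descent_iff schubert_poly_descent_divdiff schubert_poly_inj
    by metis
  then have "w = v"
    by (metis comp_transpose_transpose)
  then show ?thesis
    using w' v(1) schubert_poly_unique by blast
qed

lemma schubert_constant:
  assumes "schubert f" "\<And>i. 1 \<le> i \<Longrightarrow> divdiff i f = 0"
  shows "f = 1"
proof -
  obtain m w where w: "schubert_poly m w f"
    using assms schubert_def by blast
  then have "w i < w (Suc i)" if "1 \<le> i" "i < m" for i
    using that schubert_poly_descent_iff assms(2)
      permutes_ascent_or_descent[OF schubert_poly_permutes[OF w]] by blast
  then have "w = id"
    using no_descent_imp_id schubert_poly_permutes[OF w] by metis
  then show ?thesis
    using w schubert_poly_id by simp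
qed

section \<open>Chains of divided differences\<close>

text \<open>Adjoining 0 gives a class closed under all divided differences with positive index, so a
  chain can be applied without checking that its intermediate results are nonzero.\<close>

definition schubert0 :: "zpoly \<Rightarrow> bool" where
  "schubert0 f \<longleftrightarrow> f = 0 \<or> schubert f"

lemma schubert0_divdiff: "schubert0 f \<Longrightarrow> 1 \<le> i \<Longrightarrow> schubert0 (divdiff i f)"
  using schubert_divdiff unfolding schubert0_def by fastforce

text \<open>Every divided difference kills -1, so \<open>schubert_constant\<close> would force -1 =
  1. This is the contradiction at the end of the sign arguments below.\<close>

lemma not_schubert0_minus_1: "\<not> schubert0 (- 1)"
proof
  have neq: "(- 1 :: zpoly) \<noteq> 1"
  proof
    assume "(- 1 :: zpoly) = 1"
    then have "Poly_Mapping.lookup (- 1 :: zpoly) 0 = Poly_Mapping.lookup 1 0"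
      by simp
    then show False
      by (simp add: lookup_one)
  qed
  assume "schubert0 (- 1)"
  then have "schubert (- 1)"
    by (simp add: schubert0_def)
  then have "(- 1 :: zpoly) = 1"
    by (rule schubert_constant) (simp add: divdiff_minus)
  with neq show False ..
qed

text \<open>Index k acts first and k+D-1 last.\<close>

primrec divdiffs :: "nat \<Rightarrow> nat \<Rightarrow> zpoly \<Rightarrow> zpoly" where
  "divdiffs k 0 f = f"
| "divdiffs k (Suc D) f = divdiff (k + D) (divdiffs k D f)"

lemma divdiffs_Suc_shift: "divdiffs k (Suc D) f = divdiffs (Suc k) D (divdiff k f)"
  by (induction D) simp_all

lemma divdiffs_add: "divdiffs k D (f + g) = divdiffs k D f + divdiffs k D g"
  and divdiffs_diff: "divdiffs k D (f - g) = divdiffs k D f - divdiffs k D g"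
  and divdiffs_minus: "divdiffs k D (- f) = - divdiffs k D f"
  and divdiffs_0 [simp]: "divdiffs k D 0 = 0"
  by (induction D) (simp_all add: divdiff_add divdiff_diff divdiff_minus)

lemma divdiffs_sum: "divdiffs k D (\<Sum>i\<in>A. f i) = (\<Sum>i\<in>A. divdiffs k D (f i))"
  by (induction A rule: infinite_finite_induct) (simp_all add: divdiffs_add)

lemma schubert0_divdiffs: "schubert0 f \<Longrightarrow> 1 \<le> k \<Longrightarrow> schubert0 (divdiffs k D f)"
  by (induction D) (simp_all add: schubert0_divdiff)

text \<open>If the end of the chain is nonzero then so is every intermediate result, and the
  operators can be cancelled one at a time from the outside.\<close>

lemma schubert_divdiffs_cancel:
  assumes "schubert f" "schubert g" "1 \<le> k" "divdiffs k D f = divdiffs k D g" "divdiffs k D f \<noteq> 0"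
  shows "f = g"
  using assms(4,5)
proof (induction D)
  case (Suc D)
  have "schubert (divdiffs k D h)" if "schubert h" "divdiff (k + D) (divdiffs k D h) \<noteq> 0" for h
    using schubert0_divdiffs[of h k D] that assms(3) by (auto simp: schubert0_def)
  then have "divdiffs k D f = divdiffs k D g"
    using Suc.prems assms(1-3) by - (rule schubert_divdiff_cancel[of _ _ "k + D"], auto)
  moreover have "divdiffs k D f \<noteq> 0"
    using Suc.prems by auto
  ultimately show ?case by (rule Suc.IH)
qed simp

text \<open>For a polynomial, this means that only the variables with index less than k (and the
  unused index 0) occur.\<close>

definition sym_from :: "nat \<Rightarrow> zpoly \<Rightarrow> bool" where
  "sym_from k P \<longleftrightarrow> (\<forall>i\<ge>k. divdiff i P = 0)"

lemma sym_from_mono: "sym_from k P \<Longrightarrow> k \<le> k' \<Longrightarrow> sym_from k' P"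
  by (simp add: sym_from_def)

lemma sym_from_1 [intro]: "sym_from k 1"
  by (simp add: sym_from_def)

lemma sym_from_X [intro]: "j < k \<Longrightarrow> sym_from k (X j)"
  by (simp add: sym_from_def divdiff_X_other)

lemma sym_from_mult [intro]: "sym_from k P \<Longrightarrow> sym_from k Q \<Longrightarrow> sym_from k (P * Q)"
  by (simp add: sym_from_def divdiff_sym_mult_eq_0)

lemma sym_from_power [intro]: "sym_from k P \<Longrightarrow> sym_from k (P ^ n)"
  by (simp add: sym_from_def divdiff_sym_power_eq_0)

lemma sym_from_add [intro]: "sym_from k P \<Longrightarrow> sym_from k Q \<Longrightarrow> sym_from k (P + Q)"
  by (simp add: sym_from_def divdiff_add)

section \<open>Coefficient extraction by chains\<close>

lemma divdiffs_sym_mult: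
  assumes "sym_from k P"
  shows "divdiffs k D (P * f) = P * divdiffs k D f"
proof (induction D)
  case (Suc D)
  have "divdiff (k + D) P = 0"
    using assms by (simp add: sym_from_def)
  with Suc show ?case
    by (simp add: divdiff_sym_mult)
qed simp

lemma sym_from_divdiffs:
  assumes "sym_from (Suc k) g"
  shows "sym_from (Suc (k + D)) (divdiffs k D g)"
proof (induction D)
  case (Suc D)
  then have "divdiff i (divdiff (k + D) (divdiffs k D g)) = 0" if "i \<ge> Suc (Suc (k + D))" for i
    using that by (subst divdiff_commute) (auto simp: sym_from_def)
  then show ?case
    by (simp add: sym_from_def)
qed (use assms in simp)

text \<open>Iterated Leibniz rule: each operator moves the factor x_j to x_(j+1) and leaves one term
  without it. Only the term of the last operator survives, since \<open>divdiff (k + Suc D)\<close>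
  kills \<open>divdiffs k D g\<close>.\<close>

lemma divdiffs_X_mult:
  assumes "sym_from (Suc k) g"
  shows "divdiffs k (Suc D) (X k * g) = X (k + Suc D) * divdiffs k (Suc D) g + divdiffs k D g"
proof (induction D)
  case 0
  show ?case by (simp add: divdiff_X_mult)
next
  case (Suc D)
  have "divdiff (k + Suc D) (divdiffs k D g) = 0"
    using sym_from_divdiffs[OF assms, of D] by (simp add: sym_from_def)
  then have "divdiff (k + Suc D) (divdiffs k (Suc D) (X k * g)) =
      X (k + Suc (Suc D)) * divdiff (k + Suc D) (divdiffs k (Suc D) g) + divdiffs k (Suc D) g"
    unfolding Suc by (simp only: divdiff_add divdiff_X_mult) simp
  then show ?case
    by (simp only: divdiffs.simps(2)[of k "Suc D"])
qed

lemma divdiffs_power: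
  "p \<le> D \<Longrightarrow> divdiffs k D (X k ^ p) = (if p = D then 1 else 0)"
proof (induction p arbitrary: D)
  case 0
  have "divdiffs k (Suc E) 1 = 0" for E
    by (simp only: divdiffs_Suc_shift divdiff_1 divdiffs_0)
  then show ?case
    by (cases D) auto
next
  case (Suc p)
  then obtain E where D: "D = Suc E"
    by (cases D) auto
  have "sym_from (Suc k) (X k ^ p)"
    by auto
  then have "divdiffs k D (X k ^ Suc p) =
      X (k + Suc E) * divdiffs k (Suc E) (X k ^ p) + divdiffs k E (X k ^ p)"
    unfolding D power_Suc by (rule divdiffs_X_mult)
  also have "divdiffs k (Suc E) (X k ^ p) = 0"
    using Suc.IH[of "Suc E"] Suc.prems D by (simp del: divdiffs.simps)
  also have "divdiffs k E (X k ^ p) = (if p = E then 1 else 0)"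
    using Suc.IH[of E] Suc.prems D by simp
  finally show ?case
    using D by simp
qed

lemma divdiffs_mult_power:
  "sym_from k P \<Longrightarrow> p \<le> D \<Longrightarrow> divdiffs k D (P * X k ^ p) = (if p = D then P else 0)"
  by (simp add: divdiffs_sym_mult divdiffs_power)

lemma divdiff_swap_vars: "divdiff i (swap_vars i f) = - divdiff i f"
  by (rule divdiff_eqI) (simp add: X_diff_mult_divdiff)

lemma divdiff_power: "divdiff k (X k ^ n) = (\<Sum>j<n. X (Suc k) ^ (n - Suc j) * X k ^ j)"
  by (rule divdiff_eqI) (simp add: swap_vars_simps flip: power_diff_sumr2)

lemma divdiff_two_powers_eq_0: "divdiff k (X k ^ r * X (Suc k) ^ r) = 0"
  by (simp add: divdiff_eq_0_iff swap_vars_simps mult.commute)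

text \<open>The first operator turns the product into a sum of monomials in x_k and x_(k+1); the
  rest of the chain starts at k+1 and extracts the coefficient of x_(k+1)^D.\<close>

lemma divdiffs_two_powers:
  assumes "p \<le> Suc D" "r \<le> Suc D"
  shows "divdiffs k (Suc D) (X k ^ p * X (Suc k) ^ r) =
    (if p = Suc D then X k ^ r else 0) - (if r = Suc D then X k ^ p else 0)"
proof -
  \<comment> \<open>The case \<open>r \<le> p\<close> suffices, since exchanging x_k and x_(k+1)
    changes the sign of the first divided difference.\<close>
  have *: "divdiffs k (Suc D) (X k ^ p * X (Suc k) ^ r) =
      (if p = Suc D \<and> r \<noteq> Suc D then X k ^ r else 0)" if "r \<le> p" "p \<le> Suc D" for p r
  proof -
    have "X k ^ p * X (Suc k) ^ r = (X k ^ r * X (Suc k) ^ r) * X k ^ (p - r)"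
      using that by (simp add: mult_ac flip: power_add)
    then have "divdiff k (X k ^ p * X (Suc k) ^ r) = (X k ^ r * X (Suc k) ^ r) *
        (\<Sum>j<p - r. X (Suc k) ^ (p - r - Suc j) * X k ^ j)"
      by (simp only: divdiff_sym_mult[OF divdiff_two_powers_eq_0] divdiff_power)
    also have "\<dots> = (\<Sum>j<p - r. X k ^ (r + j) * X (Suc k) ^ (p - Suc j))"
      unfolding sum_distrib_left
    proof (intro sum.cong refl)
      fix j assume "j \<in> {..<p - r}"
      then have "p - Suc j = r + (p - r - Suc j)"
        by auto
      then show "X k ^ r * X (Suc k) ^ r * (X (Suc k) ^ (p - r - Suc j) * X k ^ j) =
          X k ^ (r + j) * X (Suc k) ^ (p - Suc j)"
        by (simp only: power_add mult_ac)
    qed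
    also have "divdiffs (Suc k) D \<dots> = (\<Sum>j<p - r. if p - Suc j = D then X k ^ (r + j) else 0)"
      unfolding divdiffs_sum using that by (intro sum.cong refl divdiffs_mult_power) auto
    \<comment> \<open>As p is at most D+1, the exponent p - (j+1) reaches D only for j = 0 and p =
      D+1.\<close>
    also have "\<dots> = (\<Sum>j<p - r. if j = 0 then if p = Suc D then X k ^ r else 0 else 0)"
      using that by (intro sum.cong) auto
    also have "\<dots> = (if p = Suc D \<and> r \<noteq> Suc D then X k ^ r else 0)"
      using that by (auto simp: sum.delta)
    finally show ?thesis
      by (simp only: divdiffs_Suc_shift)
  qed
  show ?thesis
  proof (cases "r \<le> p")
    case True
    then show ?thesis
      using assms by (auto simp: * simp del: divdiffs.simps)
  next
    case False
    have "X k ^ p * X (Suc k) ^ r = swap_vars k (X k ^ r * X (Suc k) ^ p)"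
      by (simp add: swap_vars_simps mult.commute)
    then have "divdiffs k (Suc D) (X k ^ p * X (Suc k) ^ r) =
        - divdiffs k (Suc D) (X k ^ r * X (Suc k) ^ p)"
      by (simp only: divdiffs_Suc_shift divdiff_swap_vars divdiffs_minus)
    then show ?thesis
      using False assms by (auto simp: * simp del: divdiffs.simps)
  qed
qed

lemma divdiffs_mult_two_powers:
  assumes "sym_from k P" "p \<le> Suc D" "r \<le> Suc D"
  shows "divdiffs k (Suc D) (P * (X k ^ p * X (Suc k) ^ r)) =
    P * ((if p = Suc D then X k ^ r else 0) - (if r = Suc D then X k ^ p else 0))"
  by (simp only: divdiffs_sym_mult[OF assms(1)] divdiffs_two_powers[OF assms(2,3)])

lemma X_neq_0 [simp]: "X i \<noteq> 0"
proof
  assume "X i = 0"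
  then have "poly_subst (\<lambda>_. 1 :: int) (X i) = poly_subst (\<lambda>_. 1) 0"
    by (rule arg_cong)
  then show False
    by simp
qed

text \<open>The variables are removed from the last one downwards: the chain of length
  \<open>e n\<close> starting at n extracts the coefficient of the exact power of x_n that
  occurs.\<close>

lemma schubert_remove_powers:
  assumes "schubert (P * (\<Prod>i\<in>{k..n}. X i ^ e i))" "sym_from k P" "1 \<le> k"
  shows "schubert P"
  using assms(1)
proof (induction n)
  case 0
  then show ?case using assms(3) by simp
next
  case (Suc n)
  show ?case
  proof (cases "k \<le> Suc n")
    case False
    then show ?thesis using Suc.prems by simp
  next
    case True
    let ?Q = "P * (\<Prod>i\<in>{k..n}. X i ^ e i)"
    have prod: "sym_from (Suc n) (\<Prod>i\<in>A. X i ^ e i)" if "finite A" "A \<subseteq> {..n}" for A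
      using that
      by (induction A rule: finite_induct)
        (auto simp: less_Suc_eq_le intro!: sym_from_mult sym_from_power sym_from_X)
    have "sym_from (Suc n) ?Q"
      by (rule sym_from_mult[OF sym_from_mono[OF assms(2) True] prod]) auto
    then have div: "divdiffs (Suc n) (e (Suc n)) (?Q * X (Suc n) ^ e (Suc n)) = ?Q"
      by (simp add: divdiffs_mult_power)
    have eq: "P * (\<Prod>i\<in>{k..Suc n}. X i ^ e i) = ?Q * X (Suc n) ^ e (Suc n)"
      using True by (simp add: mult_ac)
    have "schubert0 (?Q * X (Suc n) ^ e (Suc n))"
      using Suc.prems unfolding eq schubert0_def by (rule disjI2)
    from schubert0_divdiffs[OF this, of "Suc n" "e (Suc n)"] have "schubert0 ?Q"
      by (simp add: div)
    moreover have "?Q \<noteq> 0"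
      using schubert_nonzero[OF Suc.prems] unfolding eq by auto
    ultimately have "schubert ?Q"
      by (simp add: schubert0_def)
    then show ?thesis by (rule Suc.IH)
  qed
qed

section \<open>Dominant monomials\<close>

text \<open>The staircase monomial x_k^N x_(k+1)^(N-1) ... x_(k+N-1); for k = 1 it is the Schubert
  polynomial of the longest element of S_(N+1).\<close>

primrec stair :: "nat \<Rightarrow> nat \<Rightarrow> zpoly" where
  "stair 0 = (\<lambda>k. 1)"
| "stair (Suc N) = (\<lambda>k. X k ^ Suc N * stair N (Suc k))"

lemma stair_nonzero [simp]: "stair N k \<noteq> 0"
  by (induction N arbitrary: k) simp_all

lemma divdiff_stair_eq_0: "Suc i < k \<Longrightarrow> divdiff i (stair N k) = 0"
proof (induction N arbitrary: k)
  case (Suc N)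
  have "divdiff i (X k ^ Suc N) = 0"
    using Suc.prems by (intro divdiff_sym_power_eq_0 divdiff_X_other) auto
  with Suc show ?case
    by (simp add: divdiff_sym_mult_eq_0 del: power_Suc)
qed simp

text \<open>Removing one x_k leaves equal exponents at x_k and x_(k+1), so the operator just deletes
  that factor.\<close>

lemma divdiff_stair:
  "divdiff k (stair (Suc N) k) = X k ^ N * stair N (Suc k)"
proof -
  have "divdiff k (X k ^ N * stair N (Suc k)) = 0"
  proof (cases N)
    case (Suc M)
    have "divdiff k ((X k ^ Suc M * X (Suc k) ^ Suc M) * stair M (Suc (Suc k))) = 0"
      by (intro divdiff_sym_mult_eq_0 divdiff_two_powers_eq_0 divdiff_stair_eq_0) simp
    then show ?thesis
      by (simp add: Suc mult.assoc del: power_Suc)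
  qed simp
  then show ?thesis
    by (simp add: divdiff_X_mult mult.assoc)
qed

text \<open>Each operator in turn lowers the exponent of its own variable by one, which shortens the
  whole staircase by a step.\<close>

lemma divdiffs_stair: "divdiffs k (Suc N) (stair (Suc N) k) = stair N k"
proof (induction N arbitrary: k)
  case (Suc N)
  have "sym_from (Suc k) (X k ^ Suc N)"
    by (intro sym_from_power sym_from_X) simp
  then have "divdiffs (Suc k) (Suc N) (X k ^ Suc N * stair (Suc N) (Suc k)) =
      X k ^ Suc N * stair N (Suc k)"
    by (simp only: divdiffs_sym_mult Suc)
  then show ?case
    by (simp only: divdiffs_Suc_shift[of k "Suc N"] divdiff_stair stair.simps(2)[of N])
qed (simp add: divdiff_X_same)

lemma schubert_stair: "schubert (stair N 1)"
proof -
  have "stair N k = (\<Prod>j<N. X (k + j) ^ (N - j))" for k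
    by (induction N arbitrary: k) (simp_all add: prod.lessThan_Suc_shift del: prod.lessThan_Suc)
  from this[of 1] have "stair N 1 = (\<Prod>i\<in>{1..Suc N}. X i ^ (Suc N - i))"
    by (simp add: prod.atLeast1_atMost_eq)
  then show ?thesis
    using schubert_poly.longest schubert_def by metis
qed

context
  fixes P :: zpoly and k :: nat
  assumes P: "sym_from k P" and k: "1 \<le> k"
begin

lemma schubert_stair_divdiffs_le:
  assumes "schubert (P * stair N k)" "M \<le> N"
  shows "schubert (P * stair M k)"
  using assms(2,1)
proof (induction N rule: dec_induct)
  case (step N)
  have "P \<noteq> 0"
    using schubert_nonzero[OF step.prems] by auto
  moreover have "divdiffs k (Suc N) (P * stair (Suc N) k) = P * stair N k"
    by (simp only: divdiffs_sym_mult[OF P] divdiffs_stair)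
  then have "schubert0 (P * stair N k)"
    using schubert0_divdiffs[of "P * stair (Suc N) k" k "Suc N"] step.prems k
    by (simp only: schubert0_def simp_thms)
  ultimately have "schubert (P * stair N k)"
    by (simp add: schubert0_def)
  then show ?case by (rule step.IH)
qed

text \<open>Fixes the exponent of x_k at M while keeping a staircase that starts with the same
  exponent M at x_(k+1), so that the next exponent may equal M.\<close>

lemma schubert_stair_divdiff:
  assumes "schubert (P * stair N k)" "M < N"
  shows "schubert (P * X k ^ M * stair M (Suc k))"
proof -
  have S: "schubert (P * stair (Suc M) k)"
    using schubert_stair_divdiffs_le[OF assms(1) Suc_leI[OF assms(2)]] .
  have "P \<noteq> 0"
    using schubert_nonzero[OF S] by auto
  have eq: "divdiff k (P * stair (Suc M) k) = P * X k ^ M * stair M (Suc k)"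
    using P by (simp only: divdiff_sym_mult sym_from_def divdiff_stair mult.assoc)
  with \<open>P \<noteq> 0\<close> have "divdiff k (P * stair (Suc M) k) \<noteq> 0"
    by simp
  then show ?thesis
    using schubert_divdiff[OF S k] eq by simp
qed

lemma schubert_stair_split:
  assumes "schubert (P * stair N k)" "M \<le> N"
  shows "schubert (P * X k ^ M * stair (M - 1) (Suc k))"
  \<comment> \<open>For M = 0 the truncated difference M - 1 is 0, and both staircases are
    1.\<close>
  using schubert_stair_divdiffs_le[OF assms] by (cases M) (simp_all add: mult_ac)

end

lemma schubert_dominant_2:
  assumes "b \<le> a"
  shows "schubert (X 1 ^ a * X 2 ^ b)"
proof -
  have "schubert (1 * stair (Suc a) 1)"
    using schubert_stair[of "Suc a"] by (simp only: mult_1)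
  then have "schubert (1 * X 1 ^ a * stair a (Suc 1))"
    by (rule schubert_stair_divdiff[rotated 2]) auto
  then have "schubert (1 * X 1 ^ a * X (Suc 1) ^ b * stair (b - 1) (Suc (Suc 1)))"
    using assms by - (rule schubert_stair_split[rotated 2], auto)
  then have "schubert (1 * X 1 ^ a * X (Suc 1) ^ b * stair 0 (Suc (Suc 1)))"
    by (rule schubert_stair_divdiffs_le[rotated 2]) auto
  then show ?thesis
    by (simp add: numeral_2_eq_2)
qed

text \<open>Exponents are fixed from left to right. With \<open>b < a\<close> the staircase of
  length a at x_2 can be cut so that a staircase of length b remains at x_3, which covers c = b
  too.\<close>

lemma schubert_dominant_3:
  assumes "c \<le> b" "b < a"
  shows "schubert (X 1 ^ a * X 2 ^ b * X 3 ^ c)"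
proof -
  have "schubert (1 * stair (Suc a) 1)"
    using schubert_stair[of "Suc a"] by (simp only: mult_1)
  then have "schubert (1 * X 1 ^ a * stair a (Suc 1))"
    by (rule schubert_stair_divdiff[rotated 2]) auto
  then have "schubert (1 * X 1 ^ a * X (Suc 1) ^ b * stair b (Suc (Suc 1)))"
    using assms by - (rule schubert_stair_divdiff[rotated 2], auto)
  then have "schubert (1 * X 1 ^ a * X (Suc 1) ^ b * X (Suc (Suc 1)) ^ c *
      stair (c - 1) (Suc (Suc (Suc 1))))"
    using assms by - (rule schubert_stair_split[rotated 2], auto)
  then have "schubert (1 * X 1 ^ a * X (Suc 1) ^ b * X (Suc (Suc 1)) ^ c *
      stair 0 (Suc (Suc (Suc 1))))"
    by (rule schubert_stair_divdiffs_le[rotated 2]) auto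
  then show ?thesis
    by (simp add: numeral_2_eq_2 numeral_3_eq_3)
qed

section \<open>The polynomials obtained from 1432\<close>

lemma not_schubert_three_vars:
  "\<not> schubert (X 1 ^ A * X 2 ^ B * X 3 ^ C *
      (X 1 ^ 2 + X 1 * X 2 + X 2 ^ 2 + X 1 * X 3 + X 2 * X 3))"
proof
  define x y z where "x = X 1" and "y = X 2" and "z = X 3"
  define f where "f = x ^ A * y ^ B * z ^ C * (x ^ 2 + x * y + y ^ 2 + x * z + y * z)"
  assume "schubert (X 1 ^ A * X 2 ^ B * X 3 ^ C *
      (X 1 ^ 2 + X 1 * X 2 + X 2 ^ 2 + X 1 * X 3 + X 2 * X 3))"
  then have f: "schubert f"
    by (simp only: f_def x_def y_def z_def)
  have nz [simp]: "x \<noteq> 0" "y \<noteq> 0" "z \<noteq> 0"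
    by (simp_all add: x_def y_def z_def)
  have xy: "x + y \<noteq> 0" "x ^ 2 + x * y + y ^ 2 \<noteq> 0"
  proof -
    let ?ev = "poly_subst (\<lambda>_. 1 :: int)"
    have "?ev (x + y) \<noteq> ?ev 0" "?ev (x ^ 2 + x * y + y ^ 2) \<noteq> ?ev 0"
      by (simp_all add: x_def y_def poly_subst_add poly_subst_mult poly_subst_power)
    then show "x + y \<noteq> 0" "x ^ 2 + x * y + y ^ 2 \<noteq> 0"
      by metis+
  qed
  have sym [simp]: "sym_from 2 x" "sym_from 3 x" "sym_from 3 y"
    by (auto simp: x_def y_def)
  have top1: "divdiffs 1 D (x ^ p) = (if p = D then 1 else 0)" if "p \<le> D" for D p
    using divdiffs_power[OF that, of 1] by (simp only: x_def)
  have top2: "divdiffs 2 D (P * y ^ p) = (if p = D then P else 0)"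
    if "sym_from 2 P" "p \<le> D" for P D p
    using divdiffs_mult_power[OF that] by (simp only: y_def)
  have top3: "divdiffs 3 D (P * z ^ p) = (if p = D then P else 0)"
    if "sym_from 3 P" "p \<le> D" for P D p
    using divdiffs_mult_power[OF that] by (simp only: z_def)
  have top12: "divdiffs 1 (Suc D) (x ^ p * y ^ r) =
      (if p = Suc D then x ^ r else 0) - (if r = Suc D then x ^ p else 0)"
    if "p \<le> Suc D" "r \<le> Suc D" for D p r
    using divdiffs_two_powers[OF that, of 1] by (simp only: x_def y_def Suc_1)
  have "Suc 2 = 3" by simp
  then have top23: "divdiffs 2 (Suc D) (P * (y ^ p * z ^ r)) =
      P * ((if p = Suc D then y ^ r else 0) - (if r = Suc D then y ^ p else 0))"
    if "sym_from 2 P" "p \<le> Suc D" "r \<le> Suc D" for P D p r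
    using divdiffs_mult_two_powers[OF that] by (simp only: y_def z_def)
  have neg1: "\<not> schubert0 (- (x ^ D))" for D
  proof
    assume "schubert0 (- (x ^ D))"
    then have "schubert0 (divdiffs 1 D (- (x ^ D)))"
      by (rule schubert0_divdiffs) simp
    then show False
      using not_schubert0_minus_1 by (simp only: divdiffs_minus top1 order_refl simp_thms if_True)
  qed
  have neg2: "\<not> schubert0 (- (x ^ D * y ^ E))" for D E
  proof
    assume "schubert0 (- (x ^ D * y ^ E))"
    then have "schubert0 (divdiffs 2 E (- (x ^ D * y ^ E)))"
      by (rule schubert0_divdiffs) simp
    then show False
      using neg1 by (simp add: divdiffs_minus top2 sym_from_power)
  qed
  have f1: "divdiffs 3 (Suc C) f = x ^ A * y ^ B * (x + y)"
  proof -
    \<comment> \<open>Splitting by powers of z: the top power is z^(C+1), with coefficient x^A y^B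
      (x + y).\<close>
    have "f = (x ^ A * y ^ B * (x * x + x * y + y * y)) * z ^ C + (x ^ A * y ^ B * (x + y)) * z ^ Suc C"
      by (simp add: f_def power2_eq_square algebra_simps)
    moreover have "sym_from 3 (x ^ A * y ^ B * (x * x + x * y + y * y))"
      "sym_from 3 (x ^ A * y ^ B * (x + y))"
      by (intro sym_from_mult sym_from_power sym_from_add sym)+
    ultimately show ?thesis
      by (simp only: divdiffs_add top3) simp
  qed
  have "schubert0 (divdiffs 3 (Suc C) f)"
    using f by (intro schubert0_divdiffs) (simp_all add: schubert0_def)
  then have "schubert0 (x ^ A * y ^ B * (x + y))"
    by (simp only: f1)
  then have f1_schubert: "schubert (x ^ A * y ^ B * (x + y))"
    using xy by (simp add: schubert0_def)
  have f1_eq: "x ^ A * y ^ B * (x + y) = x ^ Suc A * y ^ B + x ^ A * y ^ Suc B"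
    by (simp add: algebra_simps)
  consider "A < B" | "B < A" | "A = B" "A < C" | "A = B" "A = C" | "A = B" "C < A"
    by linarith
  then show False
  proof cases
    case 1
    have "schubert0 (divdiffs 1 (Suc B) (x ^ A * y ^ B * (x + y)))"
      using f1_schubert by (intro schubert0_divdiffs) (simp_all add: schubert0_def)
    \<comment> \<open>As A+1 is at most B, only the term x^A y^(B+1) contains an exponent B+1, and
      it sits on the second variable, whence the sign.\<close>
    also have "divdiffs 1 (Suc B) (x ^ A * y ^ B * (x + y)) = - (x ^ A)"
      using 1 unfolding f1_eq divdiffs_add by (subst (1 2) top12) auto
    finally show False
      using neg1 by simp
  next
    case 2
    \<comment> \<open>This dominant monomial has the same coefficient of y^(B+1), but lacks the term
      x^(A+1) y^B.\<close>
    have "schubert (x ^ A * y ^ Suc B)"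
      using schubert_dominant_2[of "Suc B" A] 2 unfolding x_def y_def by simp
    moreover have "divdiffs 2 (Suc B) (x ^ A * y ^ B * (x + y)) = x ^ A"
      "divdiffs 2 (Suc B) (x ^ A * y ^ Suc B) = x ^ A"
      unfolding f1_eq divdiffs_add by (subst top2 | simp add: sym_from_power del: power_Suc)+
    ultimately have "x ^ A * y ^ B * (x + y) = x ^ A * y ^ Suc B"
      using f1_schubert by - (rule schubert_divdiffs_cancel[of _ _ 2 "Suc B"], simp_all)
    then show False
      unfolding f1_eq by simp
  next
    case 3
    have "schubert0 (divdiffs 2 (Suc C) f)"
      using f by (intro schubert0_divdiffs) (simp_all add: schubert0_def)
    moreover have "f = x ^ Suc (Suc A) * (y ^ A * z ^ C) + x ^ Suc A * (y ^ Suc A * z ^ C) +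
        x ^ A * (y ^ Suc (Suc A) * z ^ C) + x ^ Suc A * (y ^ A * z ^ Suc C) +
        x ^ A * (y ^ Suc A * z ^ Suc C)"
      using 3 by (simp add: f_def power2_eq_square algebra_simps)
    moreover have "divdiffs 2 (Suc C) (x ^ k * (y ^ p * z ^ r)) =
      x ^ k * ((if p = Suc C then y ^ r else 0) - (if r = Suc C then y ^ p else 0))"
      if "p \<le> Suc C" "r \<le> Suc C" for k p r
      using that by (intro top23) (auto intro: sym_from_power)
    \<comment> \<open>The two terms with z^(C+1) give the negative part. A power y^(C+1) occurs only
      if C = A+1, and its contribution x^A y^C then cancels the last term.\<close>
    ultimately have *: "schubert0 (x ^ A * (if C = Suc A then y ^ C else 0) -
        x ^ Suc A * y ^ A - x ^ A * y ^ Suc A)"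
      using 3 by (simp add: divdiffs_add del: divdiffs.simps power_Suc split: if_splits)
    show False
    proof (cases "C = Suc A")
      case True
      then have "schubert0 (- (x ^ Suc A * y ^ A))"
        using * by simp
      then show False
        using neg2 by blast
    next
      case False
      then have "schubert0 (divdiffs 2 (Suc A) (- (x ^ Suc A * y ^ A) - x ^ A * y ^ Suc A))"
        using * by (intro schubert0_divdiffs) simp_all
      then show False
        using neg1[of A]
        by (simp add: divdiffs_diff divdiffs_minus top2 sym_from_power del: divdiffs.simps power_Suc)
    qed
  next
    case 4
    \<comment> \<open>For A = B = C, f is (x y z)^A q. The power is invariant under both exchanges,
      so the operators 2 and then 1 act on q alone and give -1.\<close>
    define q where "q = x ^ 2 + x * y + y ^ 2 + x * z + y * z"
    have d2: "divdiff 2 q = y + z"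
      unfolding q_def x_def y_def z_def
      by (rule divdiff_eqI)
        (simp add: swap_vars_simps transpose_def power2_eq_square algebra_simps)
    have d1: "divdiff 1 (y + z) = - 1"
      unfolding x_def y_def z_def
      by (rule divdiff_eqI)
        (simp add: swap_vars_simps transpose_def power2_eq_square numeral_2_eq_2 algebra_simps)
    have "divdiff 2 x = 0" "divdiff 1 z = 0"
      by (simp_all add: x_def z_def divdiff_X_other)
    moreover have "divdiff 2 (y ^ A * z ^ A) = 0" "divdiff 1 (x ^ A * y ^ A) = 0"
      using divdiff_two_powers_eq_0[of 2 A] divdiff_two_powers_eq_0[of 1 A] \<open>Suc 2 = 3\<close>
      by (simp_all only: x_def y_def z_def Suc_1)
    ultimately have s2: "divdiff 2 (x ^ A * (y ^ A * z ^ A)) = 0"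
      and s1: "divdiff 1 ((x ^ A * y ^ A) * z ^ A) = 0"
      by (simp_all only: divdiff_sym_mult_eq_0 divdiff_sym_power_eq_0)
    have "f = (x ^ A * (y ^ A * z ^ A)) * q"
      using 4 by (simp add: f_def q_def mult_ac)
    then have "divdiff 2 f = ((x ^ A * y ^ A) * z ^ A) * (y + z)"
      by (simp only: divdiff_sym_mult[OF s2] d2) (simp only: mult.assoc)
    then have "divdiff 1 (divdiff 2 f) = - (x ^ A * y ^ A * z ^ A)"
      by (simp only: divdiff_sym_mult[OF s1] d1) simp
    moreover have "schubert0 (divdiffs 3 A (divdiff 1 (divdiff 2 f)))"
      using f by (intro schubert0_divdiffs schubert0_divdiff) (simp_all add: schubert0_def)
    ultimately have "schubert0 (- (x ^ A * y ^ A))"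
      by (simp add: divdiffs_minus top3 sym_from_mult sym_from_power)
    then show False
      using neg2 by blast
  next
    case 5
    \<comment> \<open>\<open>g\<close> is the part of f with the top power of z. It is a Schubert
      polynomial, being a divided difference of a dominant monomial, and the chain extracting
      z^(C+1) does not distinguish it from f.\<close>
    define g where "g = (x ^ A * y ^ A * (x + y)) * z ^ Suc C"
    have "divdiff 1 (x ^ Suc (Suc A) * y ^ A * z ^ Suc C) = g"
      unfolding g_def x_def y_def z_def
      by (rule divdiff_eqI)
        (simp add: swap_vars_simps transpose_def algebra_simps flip: Suc_1)
    moreover have "schubert (x ^ Suc (Suc A) * y ^ A * z ^ Suc C)"
      using 5 schubert_dominant_3[of "Suc C" A "Suc (Suc A)"] unfolding x_def y_def z_def by simp
    moreover have "g \<noteq> 0"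
      using xy by (simp add: g_def)
    ultimately have "schubert g"
      using schubert_divdiff[of "x ^ Suc (Suc A) * y ^ A * z ^ Suc C" 1] by simp
    moreover have "divdiffs 3 (Suc C) g = x ^ A * y ^ A * (x + y)"
    proof -
      have "sym_from 3 (x ^ A * y ^ A * (x + y))"
        by (intro sym_from_mult sym_from_power sym_from_add sym)
      then show ?thesis
        unfolding g_def by (simp only: top3 order_refl simp_thms if_True)
    qed
    moreover have "x ^ A * y ^ A * (x + y) \<noteq> 0"
      using xy by simp
    ultimately have "f = g"
      using f f1 5 by - (rule schubert_divdiffs_cancel[of f g 3 "Suc C"], simp_all)
    then have "(x ^ A * y ^ A * z ^ C) * (x ^ 2 + x * y + y ^ 2) = 0"
      using 5 by (simp add: f_def g_def algebra_simps)
    then show False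
      using xy by simp
  qed
qed

section \<open>Laurent polynomials\<close>

text \<open>The map \<open>e\<close> regards natural exponents as integers. It is injective on
  monomials, so coefficients can be read off the image.\<close>

lemma inj_poly_subst_LX:
  assumes "poly_subst LX f = poly_subst LX g"
  shows "f = g"
proof -
  define e where "e = (\<lambda>a :: nat \<Rightarrow>\<^sub>0 nat.
    \<Sum>i\<in>Poly_Mapping.keys a. Poly_Mapping.single i (int (Poly_Mapping.lookup a i)))"
  have "Poly_Mapping.lookup (e a) i = int (Poly_Mapping.lookup a i)" for a i
    by (simp add: e_def lookup_sum lookup_single when_def in_keys_iff)
  then have inj: "e a = e b \<longleftrightarrow> a = b" for a b
    by (metis of_nat_eq_iff poly_mapping_eqI)
  have pow: "LX i ^ k = Poly_Mapping.single (Poly_Mapping.single i (int k)) 1" for i k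
    by (induction k) (simp_all add: LX_def mult_single flip: single_add)
  have prod: "(\<Prod>i\<in>A. Poly_Mapping.single (h i) (1::int)) = Poly_Mapping.single (\<Sum>i\<in>A. h i) 1"
    if "finite A" for A :: "nat set" and h :: "nat \<Rightarrow> nat \<Rightarrow>\<^sub>0 int"
    using that by (induction A rule: finite_induct) (simp_all add: mult_single)
  have "poly_subst LX f =
      (\<Sum>a\<in>Poly_Mapping.keys f. Poly_Mapping.single (e a) (Poly_Mapping.lookup f a))" for f
    by (simp add: poly_subst_def pow prod of_int_eq_single mult_single e_def)
  then have "Poly_Mapping.lookup (poly_subst LX f) (e b) = Poly_Mapping.lookup f b" for f b
    by (simp add: lookup_sum lookup_single inj when_def in_keys_iff)
  then show ?thesis
    using assms by (metis poly_mapping_eqI)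
qed

theorem theorem3p1:
  fixes n :: nat and \<mu> :: "nat \<Rightarrow> nat" and S1432 :: zpoly
  assumes "n \<ge> 4"
    and "schubert_poly 4 (one_line [1, 4, 3, 2]) S1432"
  shows "\<not> (\<exists>m u f. u permutes {1..m} \<and> schubert_poly m u f \<and>
           (\<Prod>i\<in>{1..n}. LX i ^ \<mu> i) * poly_subst LX_inv S1432 = poly_subst LX f)"
proof
  assume "\<exists>m u f. u permutes {1..m} \<and> schubert_poly m u f \<and>
           (\<Prod>i\<in>{1..n}. LX i ^ \<mu> i) * poly_subst LX_inv S1432 = poly_subst LX f"
  then obtain f where f: "schubert f"
    and eq: "(\<Prod>i\<in>{1..n}. LX i ^ \<mu> i) * poly_subst LX_inv S1432 = poly_subst LX f"
    unfolding schubert_def by blast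
  \<comment> \<open>The result of clearing denominators: x_1^2 x_2^2 x_3 times S_1432 at the inverse
    variables.\<close>
  let ?q = "X 1 ^ 2 + X 1 * X 2 + X 2 ^ 2 + X 1 * X 3 + X 2 * X 3"
  let ?R = "\<Prod>i\<in>{4..n}. X i ^ \<mu> i"
  have S: "S1432 = X 1 ^ 2 * X 2 + X 1 ^ 2 * X 3 + X 1 * X 2 ^ 2 + X 1 * X 2 * X 3 + X 2 ^ 2 * X 3"
    using assms(2) schubert_poly_1432 by blast
  have S_inv: "poly_subst LX_inv S1432 * (LX 1 ^ 2 * LX 2 ^ 2 * LX 3) = poly_subst LX ?q"
  proof -
    have identity: "(a'^2 * b' + a'^2 * c' + a' * b'^2 + a' * b' * c' + b'^2 * c') * (a^2 * b^2 * c) =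
        a^2 + a * b + b^2 + a * c + b * c"
      if "a * a' = 1" "b * b' = 1" "c * c' = 1" for a b c a' b' c' :: zlaurent
      using that by algebra
    show ?thesis
      using identity[OF LX_mult_LX_inv[of 1] LX_mult_LX_inv[of 2] LX_mult_LX_inv[of 3]]
      by (simp only: S poly_subst_add poly_subst_mult poly_subst_power poly_subst_X)
  qed
  have "poly_subst LX ((\<Prod>i\<in>{1..n}. X i ^ \<mu> i) * ?q) =
      ((\<Prod>i\<in>{1..n}. LX i ^ \<mu> i) * poly_subst LX_inv S1432) * (LX 1 ^ 2 * LX 2 ^ 2 * LX 3)"
    by (simp only: poly_subst_mult poly_subst_prod poly_subst_power poly_subst_X mult.assoc flip: S_inv)
  also have "\<dots> = poly_subst LX (f * (X 1 ^ 2 * X 2 ^ 2 * X 3))"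
    unfolding eq by (simp add: poly_subst_mult poly_subst_power)
  finally have "(\<Prod>i\<in>{1..n}. X i ^ \<mu> i) * ?q = f * (X 1 ^ 2 * X 2 ^ 2 * X 3)"
    by (rule inj_poly_subst_LX)
  moreover have "(\<Prod>i\<in>{1..n}. X i ^ \<mu> i) = X 1 ^ \<mu> 1 * X 2 ^ \<mu> 2 * X 3 ^ \<mu> 3 * ?R"
  proof -
    have "{1..n} = insert 1 (insert 2 (insert 3 {4..n}))"
      using assms(1) by auto
    then show ?thesis
      by (simp add: mult.assoc)
  qed
  ultimately have main: "X 1 ^ \<mu> 1 * X 2 ^ \<mu> 2 * X 3 ^ \<mu> 3 * ?R * ?q = f * (X 1 ^ 2 * X 2 ^ 2 * X 3)"
    by simp
  \<comment> \<open>Setting one variable to 0 and the others to 1, the factor q does not vanish.\<close>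
  have not_dvd: "G * (?R * ?q) \<noteq> X j * H"
    if "j \<in> {1, 2, 3}" "poly_subst (\<lambda>i. if i = j then 0 else 1 :: int) G = 1" for j G H
  proof
    let ?ev = "poly_subst (\<lambda>i. if i = j then 0 else 1 :: int)"
    assume "G * (?R * ?q) = X j * H"
    then have "?ev (G * (?R * ?q)) = ?ev (X j * H)"
      by simp
    moreover have "?ev ?R = (\<Prod>i\<in>{4..n}. 1)"
      unfolding poly_subst_prod using that(1) by (intro prod.cong) (auto simp: poly_subst_power)
    ultimately have "?ev ?q = 0"
      using that(2) by (simp add: poly_subst_mult)
    then show False
      using that(1) by (auto simp: poly_subst_add poly_subst_mult poly_subst_power)
  qed
  have "2 \<le> \<mu> 1"
  proof (rule ccontr)
    assume "\<not> 2 \<le> \<mu> 1"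
    \<comment> \<open>If the exponent were at most 1, cancelling x_1^(\<mu> 1) in
      \<open>main\<close> would leave a factor x_1 on the right only, contrary to
      \<open>not_dvd\<close>. The same argument is used for x_2.\<close>
    then have "(2::nat) = \<mu> 1 + Suc (1 - \<mu> 1)" by simp
    then have "X 1 ^ 2 = X 1 ^ \<mu> 1 * (X 1 * X 1 ^ (1 - \<mu> 1))"
      by (metis power_Suc power_add)
    with main have "X 1 ^ \<mu> 1 * ((X 2 ^ \<mu> 2 * X 3 ^ \<mu> 3) * (?R * ?q)) =
        X 1 ^ \<mu> 1 * (X 1 * (X 1 ^ (1 - \<mu> 1) * f * (X 2 ^ 2 * X 3)))"
      by (simp only: mult_ac)
    then have "(X 2 ^ \<mu> 2 * X 3 ^ \<mu> 3) * (?R * ?q) = X 1 * (X 1 ^ (1 - \<mu> 1) * f * (X 2 ^ 2 * X 3))"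
      by simp
    then show False
      using not_dvd[of 1 "X 2 ^ \<mu> 2 * X 3 ^ \<mu> 3" "X 1 ^ (1 - \<mu> 1) * f * (X 2 ^ 2 * X 3)"]
      by (simp add: poly_subst_mult poly_subst_power)
  qed
  have "2 \<le> \<mu> 2"
  proof (rule ccontr)
    assume "\<not> 2 \<le> \<mu> 2"
    then have "(2::nat) = \<mu> 2 + Suc (1 - \<mu> 2)" by simp
    then have "X 2 ^ 2 = X 2 ^ \<mu> 2 * (X 2 * X 2 ^ (1 - \<mu> 2))"
      by (metis power_Suc power_add)
    with main have "X 2 ^ \<mu> 2 * ((X 1 ^ \<mu> 1 * X 3 ^ \<mu> 3) * (?R * ?q)) =
        X 2 ^ \<mu> 2 * (X 2 * (X 2 ^ (1 - \<mu> 2) * f * (X 1 ^ 2 * X 3)))"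
      by (simp only: mult_ac)
    then have "(X 1 ^ \<mu> 1 * X 3 ^ \<mu> 3) * (?R * ?q) = X 2 * (X 2 ^ (1 - \<mu> 2) * f * (X 1 ^ 2 * X 3))"
      by simp
    then show False
      using not_dvd[of 2 "X 1 ^ \<mu> 1 * X 3 ^ \<mu> 3" "X 2 ^ (1 - \<mu> 2) * f * (X 1 ^ 2 * X 3)"]
      by (simp add: poly_subst_mult poly_subst_power)
  qed
  have "1 \<le> \<mu> 3"
  proof (rule ccontr)
    assume "\<not> 1 \<le> \<mu> 3"
    then have "\<mu> 3 = 0" by simp
    with main have "(X 1 ^ \<mu> 1 * X 2 ^ \<mu> 2) * (?R * ?q) = X 3 * (f * (X 1 ^ 2 * X 2 ^ 2))"
      by (simp add: mult_ac)
    then show False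
      using not_dvd[of 3 "X 1 ^ \<mu> 1 * X 2 ^ \<mu> 2" "f * (X 1 ^ 2 * X 2 ^ 2)"]
      by (simp add: poly_subst_mult poly_subst_power)
  qed
  define A B C where "A = \<mu> 1 - 2" and "B = \<mu> 2 - 2" and "C = \<mu> 3 - 1"
  have "\<mu> 1 = A + 2" "\<mu> 2 = B + 2" "\<mu> 3 = Suc C"
    using \<open>2 \<le> \<mu> 1\<close> \<open>2 \<le> \<mu> 2\<close> \<open>1 \<le> \<mu> 3\<close> by (simp_all add: A_def B_def C_def)
  \<comment> \<open>With the exponents bounded below, x_1^2 x_2^2 x_3 cancels and f is the
    three-variable form times powers of x_4, ..., x_n.\<close>
  with main have "(X 1 ^ A * X 2 ^ B * X 3 ^ C * ?q * ?R) * (X 1 ^ 2 * X 2 ^ 2 * X 3) =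
      f * (X 1 ^ 2 * X 2 ^ 2 * X 3)"
    by (simp only: power_add power_Suc mult_ac)
  then have "schubert ((X 1 ^ A * X 2 ^ B * X 3 ^ C * ?q) * ?R)"
    using f by simp
  moreover have "sym_from 4 (X 1 ^ A * X 2 ^ B * X 3 ^ C * ?q)"
    by (intro sym_from_mult sym_from_add sym_from_power sym_from_X) simp_all
  ultimately have "schubert (X 1 ^ A * X 2 ^ B * X 3 ^ C * ?q)"
    by (rule schubert_remove_powers) simp
  then show False
    using not_schubert_three_vars by blast
qed

end
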